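(* Let $n\ge 1$ and $\lambda_1,\dots,\lambda_n>0$. For any lattice $\Gamma$ of the oscillator group $\mathrm{Osc}_n(\lambda_1,\dots,\lambda_n)$ there are both closed and open timelike geodesics, and both closed and open spacelike geodesics, on the compact space $\mathrm{Osc}_n(\lambda_1,\dots,\lambda_n)/\Gamma$.
   Context: For $\lambda_1,\dots,\lambda_n>0$, the oscillator group $\mathrm{Osc}_n(\lambda_1,\dots,\lambda_n)$ is the manifold $\mathbb{R}\times\mathbb{R}^{2n}\times\mathbb{R}$ with elements $(z,v,t)$ and product $$(z_1,v_1,t_1)(z_2,v_2,t_2)=\bigl(z_1+z_2+\tfrac12 v_1^{\tau}JR(t_1)v_2,\; v_1+R(t_1)v_2,\; t_1+t_2\bigr),$$ where $v^{\tau}$ is the transpose, $R(t)=e^{tN_\lambda}$, $N_\lambda=\mathrm{diag}(J_{\lambda_1},\dots,J_{\lambda_n})$ is block diagonal with blocks $J_{\mu}=\begin{pmatrix}0&-\mu\\ \mu&0\end{pmatrix}$, and $J=N_{(-1,\dots,-1)}$ is block diagonal with blocks $J_{-1}$. It is the simply connected Lie group with Lie algebra $\mathfrak{osc}_n(\lambda_1,\dots,\lambda_n)$, which has basis $Z,X_1,Y_1,\dots,X_n,Y_n,T$ and non-trivial brackets $[X_i,Y_i]=Z$, $[T,X_i]=\lambda_iY_i$, $[T,Y_i]=-\lambda_iX_i$. The basis corresponds to the coordinate directions at the identity: $Z$ to $z$, $X_i,Y_i$ to the coordinates $x_i,y_i$ of $v=(x_1,y_1,\dots,x_n,y_n)$,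 and $T$ to $t$. The group carries the bi-invariant Lorentzian metric obtained by left translation of the ad-invariant form whose only non-zero relations are $\lambda_i\langle X_i,X_i\rangle=\lambda_i\langle Y_i,Y_i\rangle=\langle Z,T\rangle=1$. A lattice here is a discrete subgroup $\Gamma$ with compact quotient. The quotient $G/\Gamma$ (cosets $g\Gamma$) carries the unique Lorentzian metric making the projection $\pi:G\to G/\Gamma$ a local isometry. A geodesic with velocity $X$ is timelike if $\langle X,X\rangle<0$ and spacelike if $\langle X,X\rangle>0$. A geodesic is closed if it is periodic, and open if it is not closed. *)

theory Defs
  imports "HOL-Analysis.Analysis" "HOL-Algebra.Coset"
begin

section \<open>Oscillator groups\<close>

text \<open>The index \<open>(i, 1)\<close> of \<open>real ^ ('n \<times> 2)\<close> is the coordinate \<open>x\<^sub>i\<close>, the index \<open>(i, 2)\<close> is \<open>y\<^sub>i\<close>.\<close>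

type_synonym 'n osc = "real \<times> (real, 'n \<times> 2) vec \<times> real"

definition mat_exp :: "real ^ 'm ^ 'm \<Rightarrow> real ^ 'm ^ 'm" where
  "mat_exp A = (\<Sum>k. (1 / fact k) *\<^sub>R (((**) A) ^^ k) (mat 1))"

definition block_diag :: "('n \<Rightarrow> real ^ 2 ^ 2) \<Rightarrow> real ^ ('n::finite \<times> 2) ^ ('n \<times> 2)" where
  "block_diag B = (\<chi> p q. if fst p = fst q then B (fst p) $ snd p $ snd q else 0)"

definition J_block :: "real \<Rightarrow> real ^ 2 ^ 2" where
  "J_block \<mu> = vector [vector [0, - \<mu>], vector [\<mu>, 0]]"

definition N_mat :: "('n \<Rightarrow> real) \<Rightarrow> real ^ ('n::finite \<times> 2) ^ ('n \<times> 2)" where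
  "N_mat lam = block_diag (\<lambda>i. J_block (lam i))"

definition J_mat :: "real ^ ('n::finite \<times> 2) ^ ('n \<times> 2)" where
  "J_mat = N_mat (\<lambda>_. -1)"

definition R_mat :: "('n \<Rightarrow> real) \<Rightarrow> real \<Rightarrow> real ^ ('n::finite \<times> 2) ^ ('n \<times> 2)" where
  "R_mat lam t = mat_exp (t *\<^sub>R N_mat lam)"

fun osc_mult :: "('n::finite \<Rightarrow> real) \<Rightarrow> 'n osc \<Rightarrow> 'n osc \<Rightarrow> 'n osc" where
  "osc_mult lam (z1, v1, t1) (z2, v2, t2) =
     (z1 + z2 + 1/2 * (v1 \<bullet> ((J_mat ** R_mat lam t1) *v v2)), v1 + R_mat lam t1 *v v2, t1 + t2)"

definition Osc :: "('n::finite \<Rightarrow> real) \<Rightarrow> 'n osc monoid" where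
  "Osc lam = \<lparr>carrier = UNIV, mult = osc_mult lam, one = (0, 0, 0)\<rparr>"


section \<open>Geodesics of a pseudo-Riemannian metric on a Euclidean space\<close>

text \<open>
  A metric is a family \<open>g p u w\<close> of nondegenerate symmetric bilinear forms in \<open>u, w\<close>, depending
  smoothly on the point \<open>p\<close>; tangent vectors are identified with elements of the space by means of
  the global linear coordinates.
\<close>

text \<open>The derivative at \<open>p\<close> in direction \<open>u\<close> of the coefficient function \<open>g(v, w)\<close>.\<close>

definition metric_deriv :: "('a::euclidean_space \<Rightarrow> 'a \<Rightarrow> 'a \<Rightarrow> real) \<Rightarrow> 'a \<Rightarrow> 'a \<Rightarrow> 'a \<Rightarrow> 'a \<Rightarrow> real" where
  "metric_deriv g p u v w = frechet_derivative (\<lambda>q. g q v w) (at p) u"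

text \<open>
  The Christoffel symbols \<open>\<Gamma>\<^sub>p(u, v)\<close> of the Levi-Civita connection: Koszul's formula for constant
  (hence commuting) vector fields \<open>u, v, w\<close>.
\<close>

definition christoffel :: "('a::euclidean_space \<Rightarrow> 'a \<Rightarrow> 'a \<Rightarrow> real) \<Rightarrow> 'a \<Rightarrow> 'a \<Rightarrow> 'a \<Rightarrow> 'a" where
  "christoffel g p u v = (THE y. \<forall>w. g p y w =
     1/2 * (metric_deriv g p u v w + metric_deriv g p v u w - metric_deriv g p w u v))"

text \<open>\<open>I\<close> is meant to be an open interval.\<close>

definition geodesic_on :: "('a::euclidean_space \<Rightarrow> 'a \<Rightarrow> 'a \<Rightarrow> real) \<Rightarrow> real set \<Rightarrow> (real \<Rightarrow> 'a) \<Rightarrow> bool" where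
  "geodesic_on g I c \<longleftrightarrow> (\<exists>c' c''. \<forall>s\<in>I.
     (c has_vector_derivative c' s) (at s) \<and> (c' has_vector_derivative c'' s) (at s) \<and>
     c'' s + christoffel g (c s) (c' s) (c' s) = 0)"


section \<open>The bi-invariant metric\<close>

text \<open>
  The form on the Lie algebra, the tangent space at \<open>(0, 0, 0)\<close>. From
  \<open>\<lambda>\<^sub>i\<langle>X\<^sub>i, X\<^sub>i\<rangle> = \<lambda>\<^sub>i\<langle>Y\<^sub>i, Y\<^sub>i\<rangle> = 1\<close> the diagonal coefficients are \<open>1 / \<lambda>\<^sub>i\<close>.
\<close>

fun osc_form :: "('n::finite \<Rightarrow> real) \<Rightarrow> 'n osc \<Rightarrow> 'n osc \<Rightarrow> real" where
  "osc_form lam (z1, v1, t1) (z2, v2, t2) =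
     z1 * t2 + t1 * z2 +
     (\<Sum>i\<in>UNIV. 1 / lam i * (v1 $ (i, 1) * v2 $ (i, 1) + v1 $ (i, 2) * v2 $ (i, 2)))"

text \<open>Tangent vectors at \<open>p\<close> are moved to the identity by the differential of left translation by
  the inverse of \<open>p\<close>.\<close>

definition osc_metric :: "('n::finite \<Rightarrow> real) \<Rightarrow> 'n osc \<Rightarrow> 'n osc \<Rightarrow> 'n osc \<Rightarrow> real" where
  "osc_metric lam p u w =
     (let dL = frechet_derivative (\<lambda>q. inv\<^bsub>Osc lam\<^esub> p \<otimes>\<^bsub>Osc lam\<^esub> q) (at p)
      in osc_form lam (dL u) (dL w))"


section \<open>Lattices and quotients\<close>

definition proj :: "('n::finite \<Rightarrow> real) \<Rightarrow> 'n osc set \<Rightarrow> 'n osc \<Rightarrow> 'n osc set" where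
  "proj lam \<Gamma> p = p <#\<^bsub>Osc lam\<^esub> \<Gamma>"

definition quotient_space :: "('n::finite \<Rightarrow> real) \<Rightarrow> 'n osc set \<Rightarrow> 'n osc set topology" where
  "quotient_space lam \<Gamma> = topology (\<lambda>U. U \<subseteq> range (proj lam \<Gamma>) \<and> open (proj lam \<Gamma> -` U))"

lemma openin_quotient_space:
  "openin (quotient_space lam \<Gamma>) U \<longleftrightarrow> U \<subseteq> range (proj lam \<Gamma>) \<and> open (proj lam \<Gamma> -` U)"
proof -
  have "istopology (\<lambda>U. U \<subseteq> range (proj lam \<Gamma>) \<and> open (proj lam \<Gamma> -` U))"
    by (auto simp: istopology_def vimage_Union)
  then show ?thesis
    by (simp add: quotient_space_def topology_inverse')
qed

lemma topspace_quotient_space: "topspace (quotient_space lam \<Gamma>) = range (proj lam \<Gamma>)"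
proof -
  have "proj lam \<Gamma> -` range (proj lam \<Gamma>) = UNIV"
    by auto
  then have "openin (quotient_space lam \<Gamma>) (range (proj lam \<Gamma>))"
    by (simp add: openin_quotient_space del: vimage_eq)
  then show ?thesis
    by (meson openin_quotient_space openin_subset openin_topspace subset_antisym)
qed

lemma quotient_map_proj: "quotient_map euclidean (quotient_space lam \<Gamma>) (proj lam \<Gamma>)"
  unfolding quotient_map_def topspace_quotient_space openin_quotient_space
  by (auto simp: vimage_def)

definition lattice_in_Osc :: "('n::finite \<Rightarrow> real) \<Rightarrow> 'n osc set \<Rightarrow> bool" where
  "lattice_in_Osc lam \<Gamma> \<longleftrightarrow>
     subgroup \<Gamma> (Osc lam) \<and> discrete \<Gamma> \<and> compact_space (quotient_space lam \<Gamma>)"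


section \<open>Geodesics on the quotient\<close>

text \<open>
  For discrete \<open>\<Gamma>\<close> the projection is a covering, its local inverses are the charts of the quotient,
  and the quotient metric is the one that makes these charts isometries. So a curve \<open>\<gamma>\<close> in the
  quotient is a geodesic iff it is, near every parameter \<open>s\<close>, the projection of a geodesic \<open>c\<close> of the
  group, and the velocity of \<open>\<gamma>\<close> at \<open>s\<close> is the image of the velocity of \<open>c\<close> at \<open>s\<close>. Two such
  \<open>c\<close> differ by right translation by an element of \<open>\<Gamma>\<close>, which is an isometry, so the scalar square
  of the velocity does not depend on the choice of \<open>c\<close>.
\<close>

definition geodesic_lift_at ::
    "('n::finite \<Rightarrow> real) \<Rightarrow> 'n osc set \<Rightarrow> (real \<Rightarrow> 'n osc set) \<Rightarrow> real \<Rightarrow> (real \<Rightarrow> 'n osc) \<Rightarrow> bool" where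
  "geodesic_lift_at lam \<Gamma> \<gamma> s c \<longleftrightarrow> (\<exists>e>0.
     geodesic_on (osc_metric lam) {s - e<..<s + e} c \<and>
     (\<forall>r\<in>{s - e<..<s + e}. \<gamma> r = proj lam \<Gamma> (c r)))"

definition quotient_geodesic :: "('n::finite \<Rightarrow> real) \<Rightarrow> 'n osc set \<Rightarrow> (real \<Rightarrow> 'n osc set) \<Rightarrow> bool" where
  "quotient_geodesic lam \<Gamma> \<gamma> \<longleftrightarrow> (\<forall>s. \<exists>c. geodesic_lift_at lam \<Gamma> \<gamma> s c)"

definition velocity_square :: "('n::finite \<Rightarrow> real) \<Rightarrow> (real \<Rightarrow> 'n osc) \<Rightarrow> real \<Rightarrow> real" where
  "velocity_square lam c s =
     osc_metric lam (c s) (vector_derivative c (at s)) (vector_derivative c (at s))"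

definition timelike_geodesic :: "('n::finite \<Rightarrow> real) \<Rightarrow> 'n osc set \<Rightarrow> (real \<Rightarrow> 'n osc set) \<Rightarrow> bool" where
  "timelike_geodesic lam \<Gamma> \<gamma> \<longleftrightarrow> quotient_geodesic lam \<Gamma> \<gamma> \<and>
     (\<forall>s. \<exists>c. geodesic_lift_at lam \<Gamma> \<gamma> s c \<and> velocity_square lam c s < 0)"

definition spacelike_geodesic :: "('n::finite \<Rightarrow> real) \<Rightarrow> 'n osc set \<Rightarrow> (real \<Rightarrow> 'n osc set) \<Rightarrow> bool" where
  "spacelike_geodesic lam \<Gamma> \<gamma> \<longleftrightarrow> quotient_geodesic lam \<Gamma> \<gamma> \<and>
     (\<forall>s. \<exists>c. geodesic_lift_at lam \<Gamma> \<gamma> s c \<and> velocity_square lam c s > 0)"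

definition closed_curve :: "(real \<Rightarrow> 'a) \<Rightarrow> bool" where
  "closed_curve \<gamma> \<longleftrightarrow> (\<exists>L>0. \<forall>s. \<gamma> (s + L) = \<gamma> s)"

abbreviation open_curve :: "(real \<Rightarrow> 'a) \<Rightarrow> bool" where
  "open_curve \<gamma> \<equiv> \<not> closed_curve \<gamma>"

end

theory Submission
  imports Defs
begin

text \<open>
  For every \<open>x\<close> the curve \<open>s \<mapsto> (as, 0, bs) (0, x, 0)\<close> is a geodesic whose velocity has scalar
  square \<open>2ab\<close>; its projection is closed iff the conjugate of some \<open>(aL, 0, bL)\<close>, \<open>L > 0\<close>, by
  \<open>(0, x, 0)\<close> lies in \<open>\<Gamma>\<close>. As \<open>\<Gamma>\<close> is countable, some ratio \<open>b / a\<close> of either sign avoids all of its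
  elements, which gives the open geodesics.

  For the closed ones we need conjugates of \<open>(z, 0, t)\<close> in \<open>\<Gamma>\<close> with \<open>t > 0\<close> and \<open>z\<close> of either sign.
  They come from Selberg's lemma: if \<open>S \<subseteq> \<Gamma>\<close> is finite, then the centralizer of \<open>S\<close> in \<open>\<Gamma>\<close> is
  cocompact in the centralizer of \<open>S\<close> in the group. If some element of \<open>\<Gamma>\<close> has a \<open>t\<close> for which no
  block of \<open>R(t)\<close> is the identity, then its centralizer is conjugate to the plane \<open>{(z, 0, t)}\<close>.
  Otherwise the times \<open>t\<close> of \<open>\<Gamma>\<close> are locally finite, so \<open>\<Gamma>\<close> meets the Heisenberg group in a
  cocompact subgroup; for a finite subset \<open>S\<close> of it whose \<open>v\<close>-components span, the centralizer is
  \<open>{(z, 0, t). R(t) = 1}\<close>, and this contains a nonzero \<open>t\<close> because conjugation by \<open>\<Gamma>\<close> moves an element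
  of \<open>S\<close>, up to the center, within a finite set.
\<close>

section \<open>Rotations and the symplectic form\<close>

lemma sum_UNIV_times_2: "(\<Sum>q\<in>UNIV. f q) = (\<Sum>i\<in>UNIV. f (i, 1::2) + f (i, 2))"
  for f :: "'n::finite \<times> 2 \<Rightarrow> 'b::comm_monoid_add"
proof -
  have "(\<Sum>q\<in>UNIV. f q) = (\<Sum>i\<in>UNIV. \<Sum>j\<in>UNIV. f (i, j))"
    unfolding sum.cartesian_product by (simp add: UNIV_Times_UNIV)
  then show ?thesis
    by (simp add: sum_2)
qed

lemma vec_times_2_eq_iff: "v = w \<longleftrightarrow> (\<forall>i. v $ (i, 1) = w $ (i, 1) \<and> v $ (i, 2) = w $ (i, 2))"
  for v w :: "real ^ ('n::finite \<times> 2)"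
  by (auto simp: vec_eq_iff forall_2)

section \<open>Powers and exponential of the block diagonal matrices\<close>

lemma N_mat_nth:
  "N_mat \<mu> $ (i, 1) $ q = (if q = (i, 2) then - \<mu> i else 0)"
  "N_mat \<mu> $ (i, 2) $ q = (if q = (i, 1) then \<mu> i else 0)"
  using exhaust_2[of "snd q"]
  by (auto simp: N_mat_def block_diag_def J_block_def prod_eq_iff)

lemma N_mat_mult_vec [simp]:
  "(N_mat \<mu> *v v) $ (i, 1) = - \<mu> i * v $ (i, 2)"
  "(N_mat \<mu> *v v) $ (i, 2) = \<mu> i * v $ (i, 1)"
  by (simp_all add: matrix_vector_mult_def N_mat_nth if_distrib if_distribR cong: if_cong)

lemma J_mat_mult_vec [simp]:
  "(J_mat *v v) $ (i, 1) = v $ (i, 2)"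
  "(J_mat *v v) $ (i, 2) = - v $ (i, 1)"
  by (simp_all add: J_mat_def)

lemma N_mat_mult_mat:
  "(N_mat \<mu> ** B) $ (i, 1) $ q = - \<mu> i * B $ (i, 2) $ q"
  "(N_mat \<mu> ** B) $ (i, 2) $ q = \<mu> i * B $ (i, 1) $ q"
  by (simp_all add: matrix_matrix_mult_def N_mat_nth if_distrib if_distribR cong: if_cong)

lemma scaleR_N_mat: "t *\<^sub>R N_mat \<mu> = N_mat (\<lambda>i. t * \<mu> i)"
proof -
  have "(t *\<^sub>R N_mat \<mu>) $ (i, j) $ q = N_mat (\<lambda>i. t * \<mu> i) $ (i, j) $ q" for i j q
    using exhaust_2[of j] by (auto simp: N_mat_nth)
  then show ?thesis
    by (auto simp: vec_eq_iff)
qed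

text \<open>Each block acts on its plane as multiplication by \<open>\<i> * \<mu> i\<close>, so the
  entries are real and imaginary parts of \<open>(\<i> * \<mu> i) ^ k\<close>. Divided by k! they
  become the Taylor terms of cosine and sine, hence \<open>cos_coeff\<close> and
  \<open>sin_coeff\<close>.\<close>

lemma N_mat_power_nth:
  fixes \<mu> :: "'n::finite \<Rightarrow> real"
  shows "(((**) (N_mat \<mu>)) ^^ k) (mat 1) $ (i, 1) $ q =
     (if q = (i, 1) then fact k * (cos_coeff k * \<mu> i ^ k) else
      if q = (i, 2) then - fact k * (sin_coeff k * \<mu> i ^ k) else 0)"
   "(((**) (N_mat \<mu>)) ^^ k) (mat 1) $ (i, 2) $ q =
     (if q = (i, 2) then fact k * (cos_coeff k * \<mu> i ^ k) else
      if q = (i, 1) then fact k * (sin_coeff k * \<mu> i ^ k) else 0)"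
proof (induction k)
  case 0
  { case 1 show ?case by (auto simp: mat_def) }
  { case 2 show ?case by (auto simp: mat_def) }
next
  case (Suc k)
  { case 1 show ?case
    by (auto simp: N_mat_mult_mat Suc cos_coeff_Suc sin_coeff_Suc field_simps) }
  { case 2 show ?case
    by (auto simp: N_mat_mult_mat Suc cos_coeff_Suc sin_coeff_Suc field_simps) }
qed

lemma sums_vec_nth: "(\<And>i. (\<lambda>k. f k $ i) sums (l $ i)) \<Longrightarrow> f sums l"
  unfolding sums_def by (intro vec_tendstoI) simp

lemma mat_exp_N_mat:
  fixes \<mu> :: "'n::finite \<Rightarrow> real"
  shows "mat_exp (N_mat \<mu>) $ (i, 1) $ q =
     (if q = (i, 1) then cos (\<mu> i) else if q = (i, 2) then - sin (\<mu> i) else 0)"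
   "mat_exp (N_mat \<mu>) $ (i, 2) $ q =
     (if q = (i, 2) then cos (\<mu> i) else if q = (i, 1) then sin (\<mu> i) else 0)"
proof -
  let ?E = "(\<chi> p q. if q = p then cos (\<mu> (fst p)) else if q = (fst p, 2) then - sin (\<mu> (fst p))
      else if q = (fst p, 1) then sin (\<mu> (fst p)) else 0) :: real ^ ('n \<times> 2) ^ ('n \<times> 2)"
  have "(\<lambda>k. ((1 / fact k) *\<^sub>R (((**) (N_mat \<mu>)) ^^ k) (mat 1)) $ p $ q) sums ?E $ p $ q" for p q
  proof (cases p)
    case (Pair i j)
    show ?thesis
      using exhaust_2[of j] cos_converges[of "\<mu> i"] sin_converges[of "\<mu> i"]
        sums_minus[OF sin_converges[of "\<mu> i"]]
      by (auto simp: Pair N_mat_power_nth)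
  qed
  then have "(\<lambda>k. (1 / fact k) *\<^sub>R (((**) (N_mat \<mu>)) ^^ k) (mat 1)) sums ?E"
    by (intro sums_vec_nth)
  then have "mat_exp (N_mat \<mu>) = ?E"
    unfolding mat_exp_def by (rule sums_unique[symmetric])
  then show "mat_exp (N_mat \<mu>) $ (i, 1) $ q =
     (if q = (i, 1) then cos (\<mu> i) else if q = (i, 2) then - sin (\<mu> i) else 0)"
   "mat_exp (N_mat \<mu>) $ (i, 2) $ q =
     (if q = (i, 2) then cos (\<mu> i) else if q = (i, 1) then sin (\<mu> i) else 0)"
    by auto
qed

text \<open>Closed form of the action of R(t): block i turns by the angle \<open>t * lam i\<close>.
  The minus sign appears because J is minus the quarter turn.\<close>

definition rot :: "('n::finite \<Rightarrow> real) \<Rightarrow> real \<Rightarrow> real ^ ('n \<times> 2) \<Rightarrow> real ^ ('n \<times> 2)" where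
  "rot lam t v = (\<chi> p. cos (t * lam (fst p)) * v $ p - sin (t * lam (fst p)) * (J_mat *v v) $ p)"

lemma rot_nth [simp]:
  "rot lam t v $ (i, 1) = cos (t * lam i) * v $ (i, 1) - sin (t * lam i) * v $ (i, 2)"
  "rot lam t v $ (i, 2) = cos (t * lam i) * v $ (i, 2) + sin (t * lam i) * v $ (i, 1)"
  by (simp_all add: rot_def)

lemma R_mat_mult_vec: "R_mat lam t *v v = rot lam t v"
proof -
  have "(\<Sum>q\<in>UNIV. (if q = (i, a) then c else if q = (i, b) then d else 0) * v $ q) =
    c * v $ (i, a) + d * v $ (i, b)" if "a \<noteq> b" for i and a b :: 2 and c d
  proof -
    have "(\<Sum>q\<in>UNIV. (if q = (i, a) then c else if q = (i, b) then d else 0) * v $ q) =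
      (\<Sum>q\<in>UNIV. (if q = (i, a) then c * v $ q else 0) + (if q = (i, b) then d * v $ q else 0))"
      using that by (intro sum.cong) auto
    then show ?thesis
      by (simp add: sum.distrib)
  qed
  then show ?thesis
    unfolding vec_times_2_eq_iff R_mat_def scaleR_N_mat
    by (simp add: matrix_vector_mult_def mat_exp_N_mat)
qed

text \<open>The standard symplectic form. Half of it, with the second vector rotated, is the
  correction in the z-coordinate of the group law.\<close>

definition sform :: "real ^ ('n::finite \<times> 2) \<Rightarrow> real ^ ('n \<times> 2) \<Rightarrow> real" where
  "sform v w = v \<bullet> (J_mat *v w)"

lemma sform_eq: "sform v w = (\<Sum>i\<in>UNIV. v $ (i, 1) * w $ (i, 2) - v $ (i, 2) * w $ (i, 1))"
  by (simp add: sform_def inner_vec_def sum_UNIV_times_2)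

lemma rot_0 [simp]: "rot lam 0 v = v"
  and rot_zero [simp]: "rot lam t 0 = 0"
  and rot_add: "rot lam t (v + w) = rot lam t v + rot lam t w"
  and rot_minus: "rot lam t (- v) = - rot lam t v"
  and rot_scaleR: "rot lam t (c *\<^sub>R v) = c *\<^sub>R rot lam t v"
  by (simp_all add: vec_times_2_eq_iff algebra_simps)

lemma rot_rot [simp]: "rot lam s (rot lam t v) = rot lam (s + t) v"
  by (simp add: vec_times_2_eq_iff distrib_right cos_add sin_add algebra_simps)

lemma linear_rot: "linear (rot lam t)"
  by (simp add: linear_iff rot_add rot_scaleR)

lemma sform_add_left: "sform (u + v) w = sform u w + sform v w"
  and sform_add_right: "sform w (u + v) = sform w u + sform w v"
  and sform_minus_left: "sform (- u) w = - sform u w"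
  and sform_minus_right: "sform u (- w) = - sform u w"
  and sform_scaleR_left: "sform (c *\<^sub>R u) w = c * sform u w"
  and sform_scaleR_right: "sform u (c *\<^sub>R w) = c * sform u w"
  and sform_zero_left [simp]: "sform 0 w = 0"
  and sform_zero_right [simp]: "sform w 0 = 0"
  by (simp_all add: sform_def algebra_simps inner_simps)
    (metis matrix_vector_mul_linear linear_neg inner_minus_right)

lemma sform_swap: "sform v w = - sform w v"
  by (simp add: sform_eq sum_negf[symmetric] mult.commute)

lemma sform_self [simp]: "sform v v = 0"
  using sform_swap[of v v] by simp

text \<open>The form is the sum of the area forms of the blocks, and plane rotations preserve
  area.\<close>

lemma sform_rot_rot [simp]: "sform (rot lam t v) (rot lam t w) = sform v w"
proof -
  have "(c * x - s * y) * (c * y' + s * x') - (c * y + s * x) * (c * x' - s * y') = x * y' - y * x'"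
    if "c = cos a" "s = sin a" for a c s x y x' y' :: real
  proof -
    have "c\<^sup>2 + s\<^sup>2 = 1" using that by simp
    then show ?thesis by algebra
  qed
  then show ?thesis
    by (simp add: sform_eq)
qed

lemma osc_mult_eq: "osc_mult lam (z1, v1, t1) (z2, v2, t2) =
   (z1 + z2 + sform v1 (rot lam t1 v2) / 2, v1 + rot lam t1 v2, t1 + t2)"
  by (simp add: sform_def R_mat_mult_vec matrix_vector_mul_assoc[symmetric])

lemma continuous_on_rot [continuous_intros]:
  fixes S :: "'a::t2_space set"
  assumes "continuous_on S f" "continuous_on S g"
  shows "continuous_on S (\<lambda>x. rot lam (f x) (g x))"
  unfolding rot_def
  by (intro continuous_intros assms bounded_linear.continuous_on[OF matrix_vector_mul_bounded_linear])

lemma continuous_on_symp [continuous_intros]: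
  fixes S :: "'a::t2_space set"
  assumes "continuous_on S f" "continuous_on S g"
  shows "continuous_on S (\<lambda>x. sform (f x) (g x))"
  unfolding sform_def
  by (intro continuous_intros assms bounded_linear.continuous_on[OF matrix_vector_mul_bounded_linear])

section \<open>The group, its metric and a family of geodesics\<close>

lemma carrier_Osc [simp]: "carrier (Osc lam) = UNIV"
  by (simp add: Osc_def)

lemma mult_Osc: "(z1, v1, t1) \<otimes>\<^bsub>Osc lam\<^esub> (z2, v2, t2) =
   (z1 + z2 + sform v1 (rot lam t1 v2) / 2, v1 + rot lam t1 v2, t1 + t2)"
  by (simp add: Osc_def osc_mult_eq del: osc_mult.simps)

lemma one_Osc: "\<one>\<^bsub>Osc lam\<^esub> = (0, 0, 0)"
  by (simp add: Osc_def)

lemma left_inv_Osc: "(- z, - rot lam (- t) v, - t) \<otimes>\<^bsub>Osc lam\<^esub> (z, v, t) = \<one>\<^bsub>Osc lam\<^esub>"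
  by (simp add: mult_Osc one_Osc sform_minus_left)

lemma group_Osc: "group (Osc lam)"
proof (rule groupI)
  show "p \<otimes>\<^bsub>Osc lam\<^esub> q \<otimes>\<^bsub>Osc lam\<^esub> r = p \<otimes>\<^bsub>Osc lam\<^esub> (q \<otimes>\<^bsub>Osc lam\<^esub> r)" for p q r
  proof -
    obtain z1 v1 t1 z2 v2 t2 z3 v3 t3 where "p = (z1, v1, t1)" "q = (z2, v2, t2)" "r = (z3, v3, t3)"
      by (metis prod_cases3)
    \<comment> \<open>The z-coordinates of the two bracketings differ exactly by this instance of
      rotation invariance.\<close>
    moreover have "sform (rot lam t1 v2) (rot lam (t1 + t2) v3) = sform v2 (rot lam t2 v3)"
      using sform_rot_rot[of lam t1 v2 "rot lam t2 v3"] by simp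
    ultimately show ?thesis
      by (simp add: mult_Osc sform_add_left sform_add_right rot_add add_divide_distrib)
  qed
  show "\<exists>q\<in>carrier (Osc lam). q \<otimes>\<^bsub>Osc lam\<^esub> p = \<one>\<^bsub>Osc lam\<^esub>" for p
    by (metis left_inv_Osc prod_cases3 UNIV_I carrier_Osc)
  show "\<one>\<^bsub>Osc lam\<^esub> \<otimes>\<^bsub>Osc lam\<^esub> p = p" for p
    by (cases p) (simp add: one_Osc mult_Osc)
qed auto

lemma inv_Osc: "inv\<^bsub>Osc lam\<^esub> (z, v, t) = (- z, - rot lam (- t) v, - t)"
  by (rule group.inv_equality[OF group_Osc left_inv_Osc]) auto

text \<open>The restriction of the ad-invariant form to the span of the X_i and Y_i.\<close>

definition lform :: "('n::finite \<Rightarrow> real) \<Rightarrow> real ^ ('n \<times> 2) \<Rightarrow> real ^ ('n \<times> 2) \<Rightarrow> real" where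
  "lform lam v w = (\<Sum>i\<in>UNIV. 1 / lam i * (v $ (i, 1) * w $ (i, 1) + v $ (i, 2) * w $ (i, 2)))"

lemma lform_rot_rot: "lform \<mu> (rot lam t v) (rot lam t w) = lform \<mu> v w"
proof -
  have "(c * x - s * y) * (c * x' - s * y') + (c * y + s * x) * (c * y' + s * x') = x * x' + y * y'"
    if "c = cos a" "s = sin a" for a c s x y x' y' :: real
  proof -
    have "c\<^sup>2 + s\<^sup>2 = 1" using that by simp
    then show ?thesis by algebra
  qed
  then show ?thesis
    by (simp add: lform_def)
qed

text \<open>In these coordinates left translation is affine, so its derivative at every point is its
  linear part. The angle leaves the first component because rotations preserve
  \<open>sform\<close>.\<close>

lemma has_derivative_left_translation:
  "((\<lambda>q. inv\<^bsub>Osc lam\<^esub> (z, v, t) \<otimes>\<^bsub>Osc lam\<^esub> q) has_derivative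
    (\<lambda>(a, x, r). (a - sform v x / 2, rot lam (- t) x, r))) (at p)"
proof -
  let ?A = "\<lambda>(a, x, r :: real). (a - sform v x / 2, rot lam (- t) x, r)"
  have "linear ?A"
    by (auto simp: linear_iff sform_add_right sform_scaleR_right rot_add rot_scaleR field_simps)
  then have "bounded_linear ?A"
    by (simp add: linear_conv_bounded_linear)
  then have "((\<lambda>q. (- z, - rot lam (- t) v, - t) + ?A q) has_derivative ?A) (at p)"
    using has_derivative_add[OF has_derivative_const bounded_linear_imp_has_derivative] by force
  moreover have "inv\<^bsub>Osc lam\<^esub> (z, v, t) \<otimes>\<^bsub>Osc lam\<^esub> q = (- z, - rot lam (- t) v, - t) + ?A q" for q
    by (cases q) (simp add: inv_Osc mult_Osc sform_minus_left del: rot_rot)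
  ultimately show ?thesis
    by simp
qed

text \<open>Rotation invariance of \<open>lform\<close> removes the time: the metric coefficients
  depend on v alone, and affinely, so their derivatives are constant.\<close>

lemma osc_metric_eq:
  "osc_metric lam (z, v, t) (a, x, r) (a', x', r') =
     (a - sform v x / 2) * r' + r * (a' - sform v x' / 2) + lform lam x x'"
  unfolding osc_metric_def frechet_derivative_at[OF has_derivative_left_translation, symmetric]
  by (simp only: Let_def split osc_form.simps lform_def[symmetric] lform_rot_rot)

lemma metric_deriv_osc_metric:
  "metric_deriv (osc_metric lam) p (b, h, c) (a, x, r) (a', x', r') =
     - (sform h x * r' + r * sform h x') / 2"
proof -
  let ?A = "\<lambda>(b :: real, h, c :: real). - (sform h x * r' + r * sform h x') / 2"
  have "linear ?A"
    by (auto simp: linear_iff sform_add_left sform_scaleR_left field_simps)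
  then have "bounded_linear ?A"
    by (simp add: linear_conv_bounded_linear)
  then have "((\<lambda>q. (a * r' + r * a' + lform lam x x') + ?A q) has_derivative ?A) (at p)"
    using has_derivative_add[OF has_derivative_const bounded_linear_imp_has_derivative] by force
  moreover have "osc_metric lam q (a, x, r) (a', x', r') = (a * r' + r * a' + lform lam x x') + ?A q" for q
    by (cases q) (simp add: osc_metric_eq field_simps)
  ultimately have "((\<lambda>q. osc_metric lam q (a, x, r) (a', x', r')) has_derivative ?A) (at p)"
    by simp
  then show ?thesis
    unfolding metric_deriv_def by (simp flip: frechet_derivative_at)
qed

section \<open>The Levi-Civita connection of the metric\<close>

lemma lform_add_left: "lform lam (v + v') w = lform lam v w + lform lam v' w"
  and lform_scaleR_left: "lform lam (c *\<^sub>R v) w = c * lform lam v w"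
  and lform_minus_left: "lform lam (- v) w = - lform lam v w"
  and lform_zero_right [simp]: "lform lam v 0 = 0"
  by (simp_all add: lform_def algebra_simps sum_distrib_left sum_subtractf sum.distrib sum_negf
      add_divide_distrib diff_divide_distrib)

text \<open>The weights of N cancel those of the form. Thus \<open>N_mat lam *v x\<close> represents
  the functional \<open>sform x\<close>, which is how N enters the Christoffel symbols.\<close>

lemma lform_N_mat: "\<forall>i. lam i > 0 \<Longrightarrow> lform lam (N_mat lam *v x) w = sform x w"
  unfolding lform_def sform_eq by (intro sum.cong) (auto simp: field_simps less_imp_neq[symmetric])

lemma lform_nondegenerate:
  assumes "\<forall>i. lam i > 0" and "\<And>w. lform lam x w = 0"
  shows "x = 0"
proof -
  have "\<forall>i\<in>UNIV. 1 / lam i * (x $ (i, 1) * x $ (i, 1) + x $ (i, 2) * x $ (i, 2)) = 0"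
    using assms(2)[of x] assms(1) unfolding lform_def
    by (subst (asm) sum_nonneg_eq_0_iff) (auto simp: less_imp_le)
  then show ?thesis
    using assms(1) by (auto simp: vec_times_2_eq_iff sum_squares_eq_zero_iff less_imp_neq[symmetric])
qed

text \<open>Koszul's formula reduces to \<open>- r * sform x x'\<close>. The vector representing it
  comes from \<open>lform_N_mat\<close>; its first component compensates the \<open>sform v\<close>
  correction in the metric.\<close>

lemma christoffel_osc_metric:
  assumes "\<forall>i. lam i > 0"
  shows "christoffel (osc_metric lam) (z, v, t) (a, x, r) (a, x, r) =
    (- (r / 2) * sform v (N_mat lam *v x), - r *\<^sub>R (N_mat lam *v x), 0)"
    (is "_ = ?Y")
proof -
  let ?g = "osc_metric lam"
  have rhs: "1 / 2 * (metric_deriv ?g (z, v, t) (a, x, r) (a, x, r) (a', x', r') +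
      metric_deriv ?g (z, v, t) (a, x, r) (a, x, r) (a', x', r')
      - metric_deriv ?g (z, v, t) (a', x', r') (a, x, r) (a, x, r)) = - r * sform x x'" for a' x' r'
    using sform_swap[of x x'] by (simp add: metric_deriv_osc_metric)
  have Y: "?g (z, v, t) ?Y (a', x', r') = - r * sform x x'" for a' x' r'
    using lform_N_mat[OF assms]
    by (simp add: osc_metric_eq lform_minus_left lform_scaleR_left sform_minus_right sform_scaleR_right)
  \<comment> \<open>Uniqueness, as \<open>THE\<close> demands: pairing with the z-direction
    determines the t-component, pairing with the v-directions the v-component, and pairing with the
    t-direction the z-component.\<close>
  have uniq: "y = ?Y" if y: "\<And>w. ?g (z, v, t) y w = ?g (z, v, t) ?Y w" for y
  proof -
    obtain b k c where yb: "y = (b, k, c)"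
      by (metis prod_cases3)
    have "c = 0"
      using y[of "(1, 0, 0)"] by (simp add: yb osc_metric_eq)
    moreover have "k + r *\<^sub>R (N_mat lam *v x) = 0"
    proof (rule lform_nondegenerate[OF assms])
      show "lform lam (k + r *\<^sub>R (N_mat lam *v x)) w = 0" for w
        using y[of "(0, w, 0)"] \<open>c = 0\<close>
        by (simp add: yb osc_metric_eq lform_add_left lform_minus_left lform_scaleR_left)
    qed
    then have "k = - r *\<^sub>R (N_mat lam *v x)"
      by (simp add: eq_neg_iff_add_eq_0)
    moreover have "b = - (r / 2) * sform v (N_mat lam *v x)"
      using y[of "(0, 0, 1)"] \<open>c = 0\<close> \<open>k = _\<close>
      by (simp add: yb osc_metric_eq)
    ultimately show ?thesis
      by (simp add: yb)
  qed
  show ?thesis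
    unfolding christoffel_def
  proof (rule the_equality)
    show "\<forall>w. ?g (z, v, t) ?Y w =
       1 / 2 * (metric_deriv ?g (z, v, t) (a, x, r) (a, x, r) w +
      metric_deriv ?g (z, v, t) (a, x, r) (a, x, r) w
      - metric_deriv ?g (z, v, t) w (a, x, r) (a, x, r))"
      unfolding split_paired_all split_paired_All rhs Y by simp
  next
    fix y
    assume "\<forall>w. ?g (z, v, t) y w =
       1 / 2 * (metric_deriv ?g (z, v, t) (a, x, r) (a, x, r) w +
      metric_deriv ?g (z, v, t) (a, x, r) (a, x, r) w
      - metric_deriv ?g (z, v, t) w (a, x, r) (a, x, r))"
    then show "y = ?Y"
      unfolding split_paired_All rhs by (intro uniq) (metis Y prod_cases3)
  qed
qed

section \<open>Geodesics from translated one-parameter subgroups\<close>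

lemma has_vector_derivative_rot:
  "((\<lambda>s. rot lam (b * s) x) has_vector_derivative b *\<^sub>R (N_mat lam *v rot lam (b * s) x)) (at s)"
proof -
  have "((\<lambda>s. rot lam (b * s) x $ (i, j)) has_real_derivative
      (b *\<^sub>R (N_mat lam *v rot lam (b * s) x)) $ (i, j)) (at s)" for i j
    using exhaust_2[of j]
    by (auto intro!: derivative_eq_intros simp: algebra_simps)
  then have "((\<lambda>s. rot lam (b * s) x $ p) has_vector_derivative
      (b *\<^sub>R (N_mat lam *v rot lam (b * s) x)) $ p) (at s)" for p
    by (cases p) (simp flip: has_real_derivative_iff_has_vector_derivative)
  then show ?thesis
    unfolding has_vector_derivative_def
    by (subst has_derivative_componentwise_within)
      (auto simp: Basis_vec_def inner_axis mult.assoc)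
qed

text \<open>A one-parameter subgroup translated on the right, which is an isometry of a bi-invariant
  metric. The right factor makes the period condition one on a conjugate of (a, 0, b).\<close>

definition osc_curve :: "('n::finite \<Rightarrow> real) \<Rightarrow> real \<Rightarrow> real \<Rightarrow> real ^ ('n \<times> 2) \<Rightarrow> real \<Rightarrow> 'n osc" where
  "osc_curve lam a b x s = (a * s, 0, b * s) \<otimes>\<^bsub>Osc lam\<^esub> (0, x, 0)"

lemma osc_curve_eq: "osc_curve lam a b x s = (a * s, rot lam (b * s) x, b * s)"
  by (simp add: osc_curve_def mult_Osc)

lemma has_vector_derivative_osc_curve:
  "(osc_curve lam a b x has_vector_derivative (a, b *\<^sub>R (N_mat lam *v rot lam (b * s) x), b)) (at s)"
  unfolding osc_curve_eq[abs_def]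
  by (auto intro!: has_vector_derivative_Pair has_vector_derivative_rot derivative_eq_intros)

lemma geodesic_on_osc_curve:
  assumes "\<forall>i. lam i > 0"
  shows "geodesic_on (osc_metric lam) I (osc_curve lam a b x)"
  unfolding geodesic_on_def
proof (intro exI ballI conjI)
  let ?N = "(*v) (N_mat lam)"
  fix s
  show "(osc_curve lam a b x has_vector_derivative (a, b *\<^sub>R ?N (rot lam (b * s) x), b)) (at s)"
    by (rule has_vector_derivative_osc_curve)
  show "((\<lambda>s. (a, b *\<^sub>R ?N (rot lam (b * s) x), b)) has_vector_derivative
      (0, b *\<^sub>R ?N (b *\<^sub>R ?N (rot lam (b * s) x)), 0)) (at s)"
    by (intro has_vector_derivative_Pair has_vector_derivative_const
        bounded_linear.has_vector_derivative[OF bounded_linear_scaleR_right]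
        bounded_linear.has_vector_derivative[OF matrix_vector_mul_bounded_linear] has_vector_derivative_rot)
  \<comment> \<open>The square of N is scalar on each block, so the z-component of the Christoffel
    term vanishes; its v-component cancels the acceleration.\<close>
  have "sform y (N_mat lam *v (N_mat lam *v y)) = 0" for y
    by (simp add: sform_eq)
  then show "(0, b *\<^sub>R ?N (b *\<^sub>R ?N (rot lam (b * s) x)), 0) + christoffel (osc_metric lam) (osc_curve lam a b x s)
     (a, b *\<^sub>R ?N (rot lam (b * s) x), b) (a, b *\<^sub>R ?N (rot lam (b * s) x), b) = 0"
    unfolding osc_curve_eq christoffel_osc_metric[OF assms]
    by (simp add: zero_prod_def matrix_vector_mult_scaleR sform_scaleR_right)
qed

text \<open>The square of the rotating component under \<open>lform\<close> cancels the two
  \<open>sform\<close> corrections in the metric, so x drops out.\<close>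

lemma velocity_square_osc_curve:
  assumes "\<forall>i. lam i > 0"
  shows "velocity_square lam (osc_curve lam a b x) s = 2 * a * b"
proof -
  have "lform lam (N_mat lam *v y) (b *\<^sub>R (N_mat lam *v y)) = b * sform y (N_mat lam *v y)" for y
    by (simp add: lform_N_mat[OF assms] sform_scaleR_right)
  then show ?thesis
    unfolding velocity_square_def vector_derivative_at[OF has_vector_derivative_osc_curve]
    by (simp add: osc_curve_eq osc_metric_eq lform_scaleR_left sform_scaleR_right algebra_simps)
qed

lemma geodesic_lift_at_osc_curve:
  assumes "\<forall>i. lam i > 0"
  shows "geodesic_lift_at lam \<Gamma> (\<lambda>s. proj lam \<Gamma> (osc_curve lam a b x s)) s (osc_curve lam a b x)"
  unfolding geodesic_lift_at_def using geodesic_on_osc_curve[OF assms] zero_less_one by blast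

lemma timelike_geodesic_osc_curve:
  assumes "\<forall>i. lam i > 0" "a * b < 0"
  shows "timelike_geodesic lam \<Gamma> (\<lambda>s. proj lam \<Gamma> (osc_curve lam a b x s))"
  unfolding timelike_geodesic_def quotient_geodesic_def
  using geodesic_lift_at_osc_curve velocity_square_osc_curve[OF assms(1), of a b x] assms
  by (metis mult.assoc mult_less_0_iff zero_less_numeral)

lemma spacelike_geodesic_osc_curve:
  assumes "\<forall>i. lam i > 0" "a * b > 0"
  shows "spacelike_geodesic lam \<Gamma> (\<lambda>s. proj lam \<Gamma> (osc_curve lam a b x s))"
  unfolding spacelike_geodesic_def quotient_geodesic_def
  using geodesic_lift_at_osc_curve velocity_square_osc_curve[OF assms(1), of a b x] assms
  by (metis mult.assoc mult_pos_pos zero_less_numeral)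

section \<open>Discrete cocompact subgroups\<close>

lemma mult_Osc_proj: "p \<otimes>\<^bsub>Osc lam\<^esub> q =
   (fst p + fst q + sform (fst (snd p)) (rot lam (snd (snd p)) (fst (snd q))) / 2,
    fst (snd p) + rot lam (snd (snd p)) (fst (snd q)), snd (snd p) + snd (snd q))"
  by (cases p; cases q) (simp add: mult_Osc)

lemma inv_Osc_proj: "inv\<^bsub>Osc lam\<^esub> p = (- fst p, - rot lam (- snd (snd p)) (fst (snd p)), - snd (snd p))"
  by (cases p) (simp add: inv_Osc)

lemma continuous_on_mult_Osc [continuous_intros]:
  fixes S :: "'a::t2_space set"
  assumes "continuous_on S f" "continuous_on S g"
  shows "continuous_on S (\<lambda>x. f x \<otimes>\<^bsub>Osc lam\<^esub> g x)"
  unfolding mult_Osc_proj by (intro continuous_intros assms) auto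

lemma continuous_on_inv_Osc [continuous_intros]:
  fixes S :: "'a::t2_space set"
  assumes "continuous_on S f"
  shows "continuous_on S (\<lambda>x. inv\<^bsub>Osc lam\<^esub> (f x))"
  unfolding inv_Osc_proj by (intro continuous_intros assms)

locale osc_lattice =
  fixes lam :: "'n::finite \<Rightarrow> real" and \<Gamma> :: "'n osc set"
  assumes lam_pos: "\<forall>i. lam i > 0"
    and lattice: "lattice_in_Osc lam \<Gamma>"
begin

sublocale group "Osc lam"
  by (rule group_Osc)

abbreviation osc_prod (infixl \<open>\<odot>\<close> 70) where
  "p \<odot> q \<equiv> p \<otimes>\<^bsub>Osc lam\<^esub> q"

abbreviation osc_inv where
  "osc_inv p \<equiv> inv\<^bsub>Osc lam\<^esub> p"

lemma subgroup_\<Gamma>: "subgroup \<Gamma> (Osc lam)"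
  and discrete_\<Gamma>: "discrete \<Gamma>"
  and compact_quotient: "compact_space (quotient_space lam \<Gamma>)"
  using lattice by (auto simp: lattice_in_Osc_def)

lemma \<Gamma>_mult: "p \<in> \<Gamma> \<Longrightarrow> q \<in> \<Gamma> \<Longrightarrow> p \<odot> q \<in> \<Gamma>"
  and \<Gamma>_inv: "p \<in> \<Gamma> \<Longrightarrow> osc_inv p \<in> \<Gamma>"
  and \<Gamma>_one: "\<one>\<^bsub>Osc lam\<^esub> \<in> \<Gamma>"
  using subgroup.m_closed[OF subgroup_\<Gamma>] subgroup.m_inv_closed[OF subgroup_\<Gamma>]
    subgroup.one_closed[OF subgroup_\<Gamma>] by simp_all

lemma inv_mult_cancel [simp]: "osc_inv p \<odot> (p \<odot> q) = q" "p \<odot> (osc_inv p \<odot> q) = q"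
  by (simp_all flip: m_assoc)

lemmas normalize = m_assoc inv_mult_group

section \<open>Periodicity in the quotient, discreteness and cocompactness\<close>

lemma proj_eq_iff: "proj lam \<Gamma> p = proj lam \<Gamma> q \<longleftrightarrow> osc_inv p \<odot> q \<in> \<Gamma>"
proof
  assume "proj lam \<Gamma> p = proj lam \<Gamma> q"
  then have "q \<in> proj lam \<Gamma> p"
    using \<Gamma>_one by (force simp: proj_def l_coset_def)
  then show "osc_inv p \<odot> q \<in> \<Gamma>"
    by (auto simp: proj_def l_coset_def)
next
  assume pq: "osc_inv p \<odot> q \<in> \<Gamma>"
  have "q \<in> p <#\<^bsub>Osc lam\<^esub> \<Gamma>"
    unfolding l_coset_def using pq by (force intro!: bexI[of _ "osc_inv p \<odot> q"])
  then show "proj lam \<Gamma> p = proj lam \<Gamma> q"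
    unfolding proj_def by (rule l_repr_independence) (simp_all add: subgroup_\<Gamma>)
qed

text \<open>The quotient of the points at s and s + 1 is the same for all s, because the elements
  (as, 0, bs) form a one-parameter group. Hence 1 is a period.\<close>

lemma closed_curve_osc_curve:
  assumes "osc_inv (0, x, 0) \<odot> (a, 0, b) \<odot> (0, x, 0) \<in> \<Gamma>"
  shows "closed_curve (\<lambda>s. proj lam \<Gamma> (osc_curve lam a b x s))"
proof -
  have "osc_inv (osc_curve lam a b x s) \<odot> osc_curve lam a b x (s + 1) =
     osc_inv (0, x, 0) \<odot> (a, 0, b) \<odot> (0, x, 0)" for s
  proof -
    have "osc_inv (a * s, 0, b * s) \<odot> (a * (s + 1), 0, b * (s + 1)) = (a, 0, b)"
      by (simp add: inv_Osc mult_Osc algebra_simps)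
    then show ?thesis
      by (simp add: osc_curve_def normalize) (simp flip: m_assoc)
  qed
  then show ?thesis
    unfolding closed_curve_def using assms by (metis proj_eq_iff zero_less_one)
qed

text \<open>Testing a period L at s = 0, where the curve passes through the identity, already puts
  (aL, 0, bL) into \<Gamma>.\<close>

lemma open_curve_osc_curve:
  assumes "\<And>L. L > 0 \<Longrightarrow> (a * L, 0, b * L) \<notin> \<Gamma>"
  shows "open_curve (\<lambda>s. proj lam \<Gamma> (osc_curve lam a b 0 s))"
proof
  assume "closed_curve (\<lambda>s. proj lam \<Gamma> (osc_curve lam a b 0 s))"
  then obtain L where "L > 0" "proj lam \<Gamma> (osc_curve lam a b 0 0) = proj lam \<Gamma> (osc_curve lam a b 0 L)"
    unfolding closed_curve_def by (metis add_0)
  then show False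
    using assms[of L] by (simp add: proj_eq_iff osc_curve_eq inv_Osc mult_Osc)
qed

text \<open>Discreteness only says that points of \<Gamma> are isolated, and an accumulation point
  could lie outside \<Gamma>. But two distinct elements close to it have a quotient in \<Gamma>
  close to the identity, which is isolated.\<close>

lemma finite_\<Gamma>_Int:
  assumes "compact C"
  shows "finite (\<Gamma> \<inter> C)"
proof (rule ccontr)
  assume "infinite (\<Gamma> \<inter> C)"
  then obtain l where l: "l islimpt (\<Gamma> \<inter> C)"
    using Heine_Borel_imp_Bolzano_Weierstrass[OF assms, of "\<Gamma> \<inter> C"] by auto
  obtain T where T: "open T" "T \<inter> \<Gamma> = {\<one>\<^bsub>Osc lam\<^esub>}"
    using discrete_\<Gamma> \<Gamma>_one unfolding discrete_def isolated_in_def by blast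
  have "continuous_on UNIV (\<lambda>q. osc_inv (fst q) \<odot> snd q)"
    by (intro continuous_intros)
  then have "open ((\<lambda>q. osc_inv (fst q) \<odot> snd q) -` T)"
    using T(1) by (simp add: continuous_on_open_vimage)
  moreover have "\<one>\<^bsub>Osc lam\<^esub> \<in> T"
    using T(2) by blast
  then have "(l, l) \<in> (\<lambda>q. osc_inv (fst q) \<odot> snd q) -` T"
    by simp
  ultimately obtain A B where AB: "open A" "open B" "(l, l) \<in> A \<times> B"
      "A \<times> B \<subseteq> (\<lambda>q. osc_inv (fst q) \<odot> snd q) -` T"
    by (rule open_prod_elim)
  then have lAB: "l \<in> A" "l \<in> B"
    by blast+
  obtain p where p: "p \<in> \<Gamma>" "p \<in> A" "p \<noteq> l"
    using islimptE[OF l lAB(1) AB(1)] by blast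
  obtain q where q: "q \<in> \<Gamma>" "q \<in> B" "q \<noteq> p"
    using islimptE[OF l, of "B - {p}"] AB(2) lAB(2) p(3) open_delete by blast
  have "(p, q) \<in> (\<lambda>q. osc_inv (fst q) \<odot> snd q) -` T"
    using AB(4) p(2) q(2) by blast
  then have "osc_inv p \<odot> q \<in> T \<inter> \<Gamma>"
    using p(1) q(1) by (simp add: \<Gamma>_mult \<Gamma>_inv)
  then have "osc_inv p \<odot> q = \<one>\<^bsub>Osc lam\<^esub>"
    using T by simp
  then have "p \<odot> (osc_inv p \<odot> q) = p \<odot> \<one>\<^bsub>Osc lam\<^esub>"
    by (rule arg_cong)
  then have "q = p"
    by simp
  with q show False by simp
qed

lemma countable_\<Gamma>: "countable \<Gamma>"
proof -
  have "\<Gamma> = (\<Union>n. \<Gamma> \<inter> cball 0 (real n))"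
  proof (intro equalityI subsetI)
    fix p assume "p \<in> \<Gamma>"
    moreover obtain n where "norm p \<le> real n"
      using real_arch_simple by blast
    ultimately show "p \<in> (\<Union>n. \<Gamma> \<inter> cball 0 (real n))"
      by (intro UN_I[of n]) simp_all
  qed simp
  then show ?thesis
    by (metis countable_UN countable_finite finite_\<Gamma>_Int compact_cball countableI_type)
qed

text \<open>The open balls around 0 project to an increasing open cover of the compact quotient, so
  a single ball meets every coset.\<close>

lemma cocompact:
  "\<exists>N. \<forall>g. \<exists>k\<in>cball 0 N. \<exists>\<gamma>\<in>\<Gamma>. g = k \<odot> \<gamma>"
proof -
  let ?U = "\<lambda>n::nat. proj lam \<Gamma> ` ball 0 (real n)"
  \<comment> \<open>The saturation of V is a union of right translates of V, so the projection is an
    open map.\<close>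
  have vim: "proj lam \<Gamma> -` (proj lam \<Gamma> ` V) = (\<Union>\<gamma>\<in>\<Gamma>. (\<lambda>q. q \<odot> osc_inv \<gamma>) -` V)" (is "?L = ?R") for V
  proof (intro equalityI subsetI)
    fix q assume "q \<in> ?L"
    then obtain p where "p \<in> V" "proj lam \<Gamma> p = proj lam \<Gamma> q"
      by (metis imageE vimageE)
    then have p: "p \<in> V" "osc_inv p \<odot> q \<in> \<Gamma>"
      by (simp_all add: proj_eq_iff)
    have "q \<odot> osc_inv (osc_inv p \<odot> q) = p"
      by (simp add: normalize)
    with p show "q \<in> ?R"
      by (intro UN_I[of "osc_inv p \<odot> q"]) simp_all
  next
    fix q assume "q \<in> ?R"
    then obtain \<gamma> where \<gamma>: "\<gamma> \<in> \<Gamma>" "q \<odot> osc_inv \<gamma> \<in> V" by auto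
    have "proj lam \<Gamma> (q \<odot> osc_inv \<gamma>) = proj lam \<Gamma> q"
      using \<gamma>(1) by (simp add: proj_eq_iff normalize)
    then show "q \<in> ?L"
      using \<gamma>(2) by (metis imageI vimageI)
  qed
  have "open ((\<lambda>q. q \<odot> osc_inv \<gamma>) -` ball 0 (real n))" for \<gamma> n
  proof -
    have "continuous_on UNIV (\<lambda>q. q \<odot> osc_inv \<gamma>)"
      by (intro continuous_intros)
    then show ?thesis
      by (simp add: continuous_on_open_vimage)
  qed
  then have open_U: "openin (quotient_space lam \<Gamma>) (?U n)" for n
    unfolding openin_quotient_space vim by auto
  have "p \<in> ball 0 (real (nat \<lceil>norm p\<rceil> + 1))" for p :: "'n osc"
    by (simp, linarith)
  then have "topspace (quotient_space lam \<Gamma>) \<subseteq> \<Union> (range ?U)"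
    unfolding topspace_quotient_space by blast
  then obtain F where F: "finite F" "F \<subseteq> range ?U" "topspace (quotient_space lam \<Gamma>) \<subseteq> \<Union> F"
    using compact_quotient open_U unfolding compact_space_alt by (metis (no_types, lifting) rangeE)
  then obtain M where M: "finite M" "F = ?U ` M"
    by (meson finite_subset_image)
  show ?thesis
  proof (intro exI allI)
    fix g
    have "proj lam \<Gamma> g \<in> \<Union> F"
      using F(3) by (auto simp: topspace_quotient_space)
    then obtain n k where n: "n \<in> M" "norm k < real n" "osc_inv k \<odot> g \<in> \<Gamma>"
      unfolding M by (auto simp: proj_eq_iff dest: sym)
    have "real n \<le> real (Max M)"
      using M n by simp
    moreover have "g = k \<odot> (osc_inv k \<odot> g)"
      by (simp add: m_assoc)
    ultimately show "\<exists>k\<in>cball 0 (real (Max M)). \<exists>\<gamma>\<in>\<Gamma>. g = k \<odot> \<gamma>"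
      using n by (intro bexI[of _ k] bexI[of _ "osc_inv k \<odot> g"]) auto
  qed
qed

text \<open>Selberg's lemma. Write g = k \<delta> with k in the ball. If g centralizes S,
  conjugating s by \<delta> equals conjugating s by the inverse of k, so the result lies in \<Gamma>
  and in a compact set. Thus only finitely many conjugation patterns \<open>\<phi> \<delta>\<close>
  occur. If d represents the pattern of \<delta>, then \<open>osc_inv d \<odot> \<delta>\<close>
  centralizes S, and k d stays in a compact set.\<close>

lemma centralizer_cocompact:
  assumes "finite S" "S \<subseteq> \<Gamma>"
  obtains C where "compact C"
    "\<And>g. (\<And>s. s \<in> S \<Longrightarrow> g \<odot> s = s \<odot> g) \<Longrightarrow>
       \<exists>c\<in>C. \<exists>\<zeta>\<in>\<Gamma>. g = c \<odot> \<zeta> \<and> (\<forall>s\<in>S. \<zeta> \<odot> s = s \<odot> \<zeta>)"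
proof -
  obtain N where N: "\<And>g. \<exists>k\<in>cball 0 N. \<exists>\<gamma>\<in>\<Gamma>. g = k \<odot> \<gamma>"
    using cocompact by blast
  define \<Delta> where "\<Delta> = {\<delta>\<in>\<Gamma>. \<exists>k\<in>cball 0 N. \<forall>s\<in>S. k \<odot> \<delta> \<odot> s = s \<odot> (k \<odot> \<delta>)}"
  define \<phi> where "\<phi> \<delta> = (\<lambda>s\<in>S. \<delta> \<odot> s \<odot> osc_inv \<delta>)" for \<delta>
  let ?F = "\<lambda>s. \<Gamma> \<inter> (\<lambda>k. osc_inv k \<odot> s \<odot> k) ` cball 0 N"
  have "compact ((\<lambda>k. osc_inv k \<odot> s \<odot> k) ` cball 0 N)" for s
    by (intro compact_continuous_image continuous_intros) auto
  then have "finite (Pi\<^sub>E S ?F)"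
    using assms(1) by (intro finite_PiE finite_\<Gamma>_Int)
  moreover have "\<phi> ` \<Delta> \<subseteq> Pi\<^sub>E S ?F"
  proof -
    have "\<delta> \<odot> s \<odot> osc_inv \<delta> \<in> ?F s" if \<delta>s: "\<delta> \<in> \<Delta>" "s \<in> S" for \<delta> s
    proof -
      obtain k where k: "k \<in> cball 0 N" "k \<odot> \<delta> \<odot> s = s \<odot> (k \<odot> \<delta>)"
        using \<delta>s unfolding \<Delta>_def by blast
      have "\<delta> \<odot> s \<odot> osc_inv \<delta> = osc_inv k \<odot> (k \<odot> \<delta> \<odot> s) \<odot> osc_inv \<delta>"
        by (simp add: m_assoc)
      also have "\<dots> = osc_inv k \<odot> s \<odot> k"
        unfolding k by (simp add: m_assoc)
      finally have "\<delta> \<odot> s \<odot> osc_inv \<delta> = osc_inv k \<odot> s \<odot> k" .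
      moreover have "\<delta> \<odot> s \<odot> osc_inv \<delta> \<in> \<Gamma>"
        using \<delta>s assms(2) by (auto simp: \<Delta>_def intro!: \<Gamma>_mult \<Gamma>_inv)
      ultimately show ?thesis
        using k(1) by auto
    qed
    then show ?thesis
      by (auto simp: \<phi>_def)
  qed
  ultimately obtain D where D: "D \<subseteq> \<Delta>" "finite D" "\<phi> ` \<Delta> = \<phi> ` D"
    by (meson finite_subset finite_subset_image order_refl)
  show ?thesis
  proof
    show "compact (\<Union>d\<in>D. (\<lambda>k. k \<odot> d) ` cball 0 N)"
      using D(2) by (intro compact_UN compact_continuous_image continuous_intros) auto
  next
    fix g assume g: "\<And>s. s \<in> S \<Longrightarrow> g \<odot> s = s \<odot> g"
    obtain k \<delta> where k: "k \<in> cball 0 N" "\<delta> \<in> \<Gamma>" "g = k \<odot> \<delta>"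
      using N by blast
    then have "\<delta> \<in> \<Delta>"
      using g unfolding \<Delta>_def by blast
    then obtain d where d: "d \<in> D" "\<phi> \<delta> = \<phi> d"
      using D by blast
    let ?\<zeta> = "osc_inv d \<odot> \<delta>"
    have "?\<zeta> \<odot> s = s \<odot> ?\<zeta>" if "s \<in> S" for s
    proof -
      have eq: "\<delta> \<odot> s \<odot> osc_inv \<delta> = d \<odot> s \<odot> osc_inv d"
        using d(2) that by (auto simp: \<phi>_def dest: fun_cong[of _ _ s])
      have "?\<zeta> \<odot> s = osc_inv d \<odot> (\<delta> \<odot> s \<odot> osc_inv \<delta>) \<odot> \<delta>"
        by (simp add: m_assoc)
      also have "\<dots> = s \<odot> ?\<zeta>"
        unfolding eq by (simp add: m_assoc)
      finally show ?thesis .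
    qed
    moreover have "g = (k \<odot> d) \<odot> ?\<zeta>"
      unfolding k by (simp add: m_assoc)
    moreover have "?\<zeta> \<in> \<Gamma>"
      using D d k by (auto simp: \<Delta>_def intro!: \<Gamma>_mult \<Gamma>_inv)
    ultimately show "\<exists>c\<in>\<Union>d\<in>D. (\<lambda>k. k \<odot> d) ` cball 0 N. \<exists>\<zeta>\<in>\<Gamma>. g = c \<odot> \<zeta> \<and> (\<forall>s\<in>S. \<zeta> \<odot> s = s \<odot> \<zeta>)"
      using d(1) k(1) by blast
  qed
qed

text \<open>The countably many slopes of elements of \<Gamma> cannot fill an interval. Elements with
  z = 0 only contribute the slope 0, by the convention for division, and b is positive. The sign of
  \<sigma> will decide the causal type.\<close>

lemma exists_slope_avoiding_\<Gamma>:
  assumes "\<sigma> \<noteq> 0"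
  obtains b where "b > 0" "\<And>L. L > 0 \<Longrightarrow> (\<sigma> * L, 0, b * L) \<notin> \<Gamma>"
proof -
  have "uncountable {0<..<1::real}"
    by (simp add: uncountable_open_interval)
  then have "\<not> {0<..<1::real} \<subseteq> (\<lambda>(z, v, t). \<sigma> * t / z) ` \<Gamma>"
    using countable_\<Gamma> countable_subset by blast
  then obtain b where b: "b > 0" "b \<notin> (\<lambda>(z, v, t). \<sigma> * t / z) ` \<Gamma>"
    unfolding subset_iff greaterThanLessThan_iff by blast
  have "(\<sigma> * L, 0, b * L) \<notin> \<Gamma>" if "L > 0" for L
  proof
    assume "(\<sigma> * L, 0, b * L) \<in> \<Gamma>"
    moreover have "b = \<sigma> * (b * L) / (\<sigma> * L)"
      using that assms by simp
    ultimately show False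
      using b(2) by force
  qed
  with b show ?thesis using that by blast
qed

end

section \<open>Lattice elements in both quadrants\<close>

text \<open>A plane rotation fixing a nonzero vector is trivial: pairing the fixed-point equations
  with the vector cancels the sine terms. Throughout, cosine 1 encodes that block i of R(t) is the
  identity.\<close>

lemma rot_fixed_imp_cos:
  assumes "rot lam t w = w" "w $ (i, j) \<noteq> 0"
  shows "cos (t * lam i) = 1"
proof -
  let ?c = "cos (t * lam i)" and ?s = "sin (t * lam i)" and ?x = "w $ (i, 1)" and ?y = "w $ (i, 2)"
  have "?c * ?x - ?s * ?y = ?x" "?c * ?y + ?s * ?x = ?y"
    using arg_cong[OF assms(1), of "\<lambda>v. v $ (i, 1)"] arg_cong[OF assms(1), of "\<lambda>v. v $ (i, 2)"]
    by simp_all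
  then have "(1 - ?c) * ?x = - ?s * ?y" "(1 - ?c) * ?y = ?s * ?x"
    by (simp_all add: algebra_simps)
  moreover have "(1 - ?c) * (?x\<^sup>2 + ?y\<^sup>2) = (1 - ?c) * ?x * ?x + (1 - ?c) * ?y * ?y"
    by (simp add: algebra_simps power2_eq_square)
  ultimately have "(1 - ?c) * (?x\<^sup>2 + ?y\<^sup>2) = 0"
    by simp
  moreover have "?x\<^sup>2 + ?y\<^sup>2 \<noteq> 0"
    using assms(2) exhaust_2[of j] by (auto simp: sum_power2_eq_zero_iff)
  ultimately show ?thesis
    by auto
qed

lemma rot_eq_self:
  assumes "\<forall>i. cos (t * lam i) = 1"
  shows "rot lam t w = w"
proof -
  have "sin (t * lam i) = 0" for i
    using assms cos_one_sin_zero by blast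
  then show ?thesis
    using assms by (simp add: vec_times_2_eq_iff)
qed

lemma rot_fixed_imp_zero:
  assumes "rot lam t w = w" "\<forall>i. cos (t * lam i) \<noteq> 1"
  shows "w = 0"
proof -
  have "w $ (i, j) = 0" for i j
    using rot_fixed_imp_cos[OF assms(1)] assms(2) by blast
  then show ?thesis
    by (simp add: vec_eq_iff)
qed

text \<open>R(t) - 1 is injective, hence surjective in finite dimension. This lets a conjugation
  remove the v-component of a group element.\<close>

lemma surj_rot_diff:
  assumes "\<forall>i. cos (t * lam i) \<noteq> 1"
  shows "\<exists>x. rot lam t x - x = v"
proof -
  have lin: "linear (\<lambda>x. rot lam t x - x)"
    by (rule linear_compose_sub[OF linear_rot linear_ident])
  have "inj (\<lambda>x. rot lam t x - x)"
    unfolding linear_injective_0[OF lin] right_minus_eq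
    using rot_fixed_imp_zero assms by blast
  then show ?thesis
    using surjD[OF linear_injective_imp_surjective[OF lin], of v] by (simp add: eq_commute)
qed

lemma inner_eq_lform: "v \<bullet> w = lform (\<lambda>_. 1) v w"
  by (simp add: inner_vec_def sum_UNIV_times_2 lform_def)

lemma norm_rot [simp]: "norm (rot lam t v) = norm v"
  by (simp add: norm_eq_sqrt_inner inner_eq_lform lform_rot_rot)

lemma sform_nondegenerate:
  assumes "\<And>w. sform v w = 0"
  shows "v = 0"
proof -
  have "sform v (J_mat *v v) = - (v \<bullet> v)"
    by (simp add: sform_eq inner_vec_def sum_UNIV_times_2 flip: sum_negf)
  then show ?thesis
    using assms by simp
qed

text \<open>A proper subspace has a nonzero normal vector, and the point at distance B + 1 along it
  is too far from the subspace.\<close>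

lemma subspace_near_imp_UNIV:
  fixes W :: "'a::euclidean_space set"
  assumes "subspace W" "\<And>x. \<exists>w\<in>W. norm (x - w) \<le> B"
  shows "W = UNIV"
proof (rule ccontr)
  assume "W \<noteq> UNIV"
  then obtain a where a: "a \<noteq> 0" "\<And>x. x \<in> W \<Longrightarrow> orthogonal a x"
    using orthogonal_to_subspace_exists_gen[of W UNIV] assms(1)
    by (metis UNIV_I psubsetI span_UNIV span_eq_iff subset_UNIV)
  obtain w where w: "w \<in> W" "norm (((B + 1) / norm a) *\<^sub>R a - w) \<le> B"
    using assms(2) by blast
  let ?x = "((B + 1) / norm a) *\<^sub>R a"
  have "B \<ge> 0"
    using w(2) norm_ge_zero order_trans by blast
  have "(B + 1)\<^sup>2 = norm ?x ^ 2"
    using a(1) by simp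
  also have "\<dots> \<le> norm (?x - w) ^ 2"
    using a(2)[OF w(1)] norm_add_Pythagorean[of ?x "- w"]
    by (simp add: orthogonal_def)
  also have "\<dots> \<le> B\<^sup>2"
    using w(2) by (intro power_mono) auto
  finally show False
    using \<open>B \<ge> 0\<close> by (simp add: power2_eq_square algebra_simps)
qed

lemma finite_cos_eq_1:
  fixes l B :: real
  assumes "l > 0"
  shows "finite {t. \<bar>t\<bar> \<le> B \<and> cos (t * l) = 1}"
proof -
  \<comment> \<open>The solutions are t l = 2 pi n; the crude bound 1 \<le> 2 pi confines n to this
    range.\<close>
  let ?M = "\<lceil>\<bar>B * l\<bar>\<rceil>"
  have "{t. \<bar>t\<bar> \<le> B \<and> cos (t * l) = 1} \<subseteq> (\<lambda>n::int. of_int n * 2 * pi / l) ` {- ?M..?M}"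
  proof (clarsimp simp: cos_one_2pi_int)
    fix t and n :: int
    assume t: "\<bar>t\<bar> \<le> B" "t * l = of_int n * 2 * pi"
    have "\<bar>of_int n\<bar> * 1 \<le> \<bar>of_int n\<bar> * (2 * pi)"
      using pi_ge_two by (intro mult_left_mono) auto
    also have "\<dots> = \<bar>t\<bar> * l"
      using arg_cong[OF t(2), of abs] assms by (simp add: abs_mult)
    also have "\<dots> \<le> \<bar>B * l\<bar>"
      using t(1) assms by (simp add: abs_mult mult_right_mono)
    finally have "\<bar>n\<bar> \<le> ?M"
      by linarith
    then show "t \<in> (\<lambda>n::int. of_int n * 2 * pi / l) ` {- ?M..?M}"
      using assms t(2) by (intro image_eqI[of _ _ n]) (auto simp: field_simps)
  qed
  then show ?thesis
    using finite_surj by blast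
qed

context osc_lattice
begin

text \<open>Selberg's lemma read in the (z, t)-plane: the part of the conjugated plane that lies in
  \<Gamma> comes within B of every point (a, m \<tau>), in particular of points deep inside either
  quadrant. Discrete steps \<tau> suffice and cover the case where only periods of R centralize
  S.\<close>

lemma exists_conj_in_\<Gamma>:
  assumes S: "finite S" "S \<subseteq> \<Gamma>"
    and centralizer: "\<And>g. (\<And>s. s \<in> S \<Longrightarrow> g \<odot> s = s \<odot> g) \<Longrightarrow> \<exists>z t. g = osc_inv p \<odot> (z, 0, t) \<odot> p"
    and "\<tau> > 0"
    and commute: "\<And>a m s. s \<in> S \<Longrightarrow>
      (osc_inv p \<odot> (a, 0, real m * \<tau>) \<odot> p) \<odot> s = s \<odot> (osc_inv p \<odot> (a, 0, real m * \<tau>) \<odot> p)"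
  shows "\<exists>z t. z > 0 \<and> t > 0 \<and> osc_inv p \<odot> (z, 0, t) \<odot> p \<in> \<Gamma>"
    and "\<exists>z t. z < 0 \<and> t > 0 \<and> osc_inv p \<odot> (z, 0, t) \<odot> p \<in> \<Gamma>"
proof -
  obtain C where C: "compact C" "\<And>g. (\<And>s. s \<in> S \<Longrightarrow> g \<odot> s = s \<odot> g) \<Longrightarrow>
       \<exists>c\<in>C. \<exists>\<zeta>\<in>\<Gamma>. g = c \<odot> \<zeta> \<and> (\<forall>s\<in>S. \<zeta> \<odot> s = s \<odot> \<zeta>)"
    using centralizer_cocompact[OF S] by blast
  \<comment> \<open>Plane coordinates are read after undoing the conjugation by p, so the compact
    set is conjugated before it is bounded.\<close>
  have "bounded ((\<lambda>c. p \<odot> c \<odot> osc_inv p) ` C)"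
    using C(1) by (intro compact_imp_bounded compact_continuous_image continuous_intros)
  then obtain B where B: "\<And>c. c \<in> C \<Longrightarrow> norm (p \<odot> c \<odot> osc_inv p) \<le> B"
    unfolding bounded_iff by blast
  have near: "\<exists>z t. osc_inv p \<odot> (z, 0, t) \<odot> p \<in> \<Gamma> \<and> \<bar>a - z\<bar> \<le> B \<and> \<bar>real m * \<tau> - t\<bar> \<le> B" for a m
  proof -
    let ?g = "osc_inv p \<odot> (a, 0, real m * \<tau>) \<odot> p"
    obtain c \<zeta> where c: "c \<in> C" "\<zeta> \<in> \<Gamma>" "?g = c \<odot> \<zeta>" "\<forall>s\<in>S. \<zeta> \<odot> s = s \<odot> \<zeta>"
      using C(2)[of ?g, OF commute] by blast
    obtain z t where z: "\<zeta> = osc_inv p \<odot> (z, 0, t) \<odot> p"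
      using centralizer[of \<zeta>, OF c(4)[rule_format]] by blast
    have "p \<odot> c \<odot> osc_inv p = p \<odot> (c \<odot> \<zeta>) \<odot> osc_inv \<zeta> \<odot> osc_inv p"
      by (simp add: m_assoc)
    also have "\<dots> = (a, 0, real m * \<tau>) \<odot> osc_inv (z, 0, t)"
      unfolding c(3)[symmetric] unfolding z by (simp add: normalize)
    also have "\<dots> = (a - z, 0, real m * \<tau> - t)"
      by (simp add: inv_Osc mult_Osc)
    finally have "norm (a - z, 0 :: real ^ ('n \<times> 2), real m * \<tau> - t) \<le> B"
      using B[OF c(1)] by simp
    then have "\<bar>a - z\<bar> \<le> B" "norm (0 :: real ^ ('n \<times> 2), real m * \<tau> - t) \<le> B"
      using norm_fst_le[of "a - z" "(0 :: real ^ ('n \<times> 2), real m * \<tau> - t)"]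
        norm_snd_le[of "(0 :: real ^ ('n \<times> 2), real m * \<tau> - t)" "a - z"] by auto
    then show ?thesis
      using c(2) z norm_snd_le[of "real m * \<tau> - t" "0 :: real ^ ('n \<times> 2)"] by auto
  qed
  \<comment> \<open>A point with z-coordinate B + 1 or - B - 1 and time above B keeps the signs of
    both coordinates when moved by at most B.\<close>
  obtain m :: nat where m: "real m * \<tau> > B"
    using reals_Archimedean3[OF \<open>\<tau> > 0\<close>] by blast
  obtain z t where "osc_inv p \<odot> (z, 0, t) \<odot> p \<in> \<Gamma>" "\<bar>(B + 1) - z\<bar> \<le> B" "\<bar>real m * \<tau> - t\<bar> \<le> B"
    using near by blast
  moreover from this m have "z > 0" "t > 0"
    by linarith+
  ultimately show "\<exists>z t. z > 0 \<and> t > 0 \<and> osc_inv p \<odot> (z, 0, t) \<odot> p \<in> \<Gamma>"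
    by blast
  obtain z t where "osc_inv p \<odot> (z, 0, t) \<odot> p \<in> \<Gamma>" "\<bar>(- B - 1) - z\<bar> \<le> B" "\<bar>real m * \<tau> - t\<bar> \<le> B"
    using near by blast
  moreover from this m have "z < 0" "t > 0"
    by linarith+
  ultimately show "\<exists>z t. z < 0 \<and> t > 0 \<and> osc_inv p \<odot> (z, 0, t) \<odot> p \<in> \<Gamma>"
    by blast
qed

text \<open>Conjugation by (0, x, 0) adds x - R(t0) x to v0, so a suitable x removes v0. An element
  commuting with the result has a v-component fixed by R(t0), hence zero.\<close>

lemma regular_element_case:
  assumes "(z0, v0, t0) \<in> \<Gamma>" "\<forall>i. cos (t0 * lam i) \<noteq> 1"
  shows "\<exists>x. (\<exists>z t. z > 0 \<and> t > 0 \<and> osc_inv (0, x, 0) \<odot> (z, 0, t) \<odot> (0, x, 0) \<in> \<Gamma>) \<and>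
    (\<exists>z t. z < 0 \<and> t > 0 \<and> osc_inv (0, x, 0) \<odot> (z, 0, t) \<odot> (0, x, 0) \<in> \<Gamma>)"
proof -
  obtain x where x: "rot lam t0 x - x = v0"
    using surj_rot_diff[OF assms(2)] by blast
  let ?p = "(0, x, 0) :: 'n osc"
  obtain z1 where z1: "?p \<odot> (z0, v0, t0) \<odot> osc_inv ?p = (z1, 0, t0)"
    by (simp add: mult_Osc inv_Osc rot_minus flip: x)
  then have \<gamma>: "(z0, v0, t0) = osc_inv ?p \<odot> (z1, 0, t0) \<odot> ?p"
    by (simp add: m_assoc flip: z1)
  have cent: "\<exists>z t. g = osc_inv ?p \<odot> (z, 0, t) \<odot> ?p" if "g \<odot> (z0, v0, t0) = (z0, v0, t0) \<odot> g" for g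
  proof -
    obtain z v t where g': "?p \<odot> g \<odot> osc_inv ?p = (z, v, t)"
      by (metis prod_cases3)
    have "(?p \<odot> g \<odot> osc_inv ?p) \<odot> (z1, 0, t0) = ?p \<odot> (g \<odot> (z0, v0, t0)) \<odot> osc_inv ?p"
      unfolding \<gamma> by (simp add: m_assoc)
    also have "\<dots> = (z1, 0, t0) \<odot> (?p \<odot> g \<odot> osc_inv ?p)"
      unfolding that unfolding \<gamma> by (simp add: m_assoc)
    finally have "rot lam t0 v = v"
      unfolding g' by (simp add: mult_Osc)
    then have "v = 0"
      using assms(2) by (rule rot_fixed_imp_zero)
    moreover have "g = osc_inv ?p \<odot> (?p \<odot> g \<odot> osc_inv ?p) \<odot> ?p"
      by (simp add: m_assoc)
    ultimately show ?thesis
      unfolding g' by blast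
  qed
  have comm: "(osc_inv ?p \<odot> (a, 0, b) \<odot> ?p) \<odot> (z0, v0, t0) = (z0, v0, t0) \<odot> (osc_inv ?p \<odot> (a, 0, b) \<odot> ?p)" for a b
  proof -
    have "(a, 0, b) \<odot> (z1, 0, t0) = (z1, 0, t0) \<odot> (a, 0, b)"
      by (simp add: mult_Osc)
    then have "osc_inv ?p \<odot> ((a, 0, b) \<odot> (z1, 0, t0)) \<odot> ?p = osc_inv ?p \<odot> ((z1, 0, t0) \<odot> (a, 0, b)) \<odot> ?p"
      by simp
    then show ?thesis
      unfolding \<gamma> by (simp add: m_assoc)
  qed
  have centralizer: "\<exists>z t. g = osc_inv ?p \<odot> (z, 0, t) \<odot> ?p"
    if "\<And>s. s \<in> {(z0, v0, t0)} \<Longrightarrow> g \<odot> s = s \<odot> g" for g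
    by (rule cent) (rule that, simp)
  have commute: "(osc_inv ?p \<odot> (a, 0, real m * 1) \<odot> ?p) \<odot> s = s \<odot> (osc_inv ?p \<odot> (a, 0, real m * 1) \<odot> ?p)"
    if "s \<in> {(z0, v0, t0)}" for a m s
    using comm[of a "real m * 1"] that by simp
  have S: "finite {(z0, v0, t0)}" "{(z0, v0, t0)} \<subseteq> \<Gamma>"
    using assms(1) by simp_all
  \<comment> \<open>The whole conjugated plane centralizes the chosen element, so any positive step
    serves; 1 is taken.\<close>
  note * = exists_conj_in_\<Gamma>[where S = "{(z0, v0, t0)}" and p = ?p and \<tau> = 1,
      OF S centralizer zero_less_one commute]
  show ?thesis
    by (intro exI[of _ x] conjI *)
qed

end

section \<open>The Heisenberg subgroup and the singular case\<close>

lemma norm_components_le: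
  fixes v :: "real ^ ('n::finite \<times> 2)"
  assumes "norm (z, v, t :: real) \<le> B"
  shows "\<bar>z :: real\<bar> \<le> B" "norm v \<le> B" "\<bar>t\<bar> \<le> B"
proof -
  have "norm z \<le> norm (z, v, t)" "norm (v, t) \<le> norm (z, v, t)"
    "norm v \<le> norm (v, t)" "norm t \<le> norm (v, t)"
    by (rule norm_fst_le norm_snd_le)+
  then show "\<bar>z :: real\<bar> \<le> B" "norm v \<le> B" "\<bar>t\<bar> \<le> B"
    using assms by simp_all
qed

context osc_lattice
begin

lemma conj_0: "osc_inv (0, 0, 0) \<odot> q \<odot> (0, 0, 0) = q"
  unfolding one_Osc[of lam, symmetric] by simp

text \<open>Under the assumption only finitely many times of \<Gamma> lie in [-N, N]. For (0, w, 0)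
  = k \<gamma> the time of \<gamma> is one of them. Dividing \<gamma> by a fixed representative
  \<open>r t\<close> of that time gives an element of time 0, while k times the representative
  ranges over a compact set.\<close>

lemma nilradical_cocompact:
  assumes "\<forall>z v t. (z, v, t) \<in> \<Gamma> \<longrightarrow> (\<exists>i. cos (t * lam i) = 1)"
  shows "\<exists>B. \<forall>w. \<exists>z l. (z, l, 0) \<in> \<Gamma> \<and> norm (w - l) \<le> B"
proof -
  obtain N where N: "\<And>g. \<exists>k\<in>cball 0 N. \<exists>\<gamma>\<in>\<Gamma>. g = k \<odot> \<gamma>"
    using cocompact by blast
  define T where "T = {t. \<bar>t\<bar> \<le> N \<and> (\<exists>z v. (z, v, t) \<in> \<Gamma>)}"
  have "T \<subseteq> (\<Union>i. {t. \<bar>t\<bar> \<le> N \<and> cos (t * lam i) = 1})"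
    unfolding T_def using assms by blast
  then have "finite T"
    by (rule finite_subset) (simp add: finite_cos_eq_1 lam_pos)
  have "\<forall>t\<in>T. \<exists>\<gamma>. \<gamma> \<in> \<Gamma> \<and> snd (snd \<gamma>) = t"
  proof
    fix t assume "t \<in> T"
    then obtain z v where "(z, v, t) \<in> \<Gamma>"
      unfolding T_def by blast
    then show "\<exists>\<gamma>. \<gamma> \<in> \<Gamma> \<and> snd (snd \<gamma>) = t"
      by (intro exI[of _ "(z, v, t)"]) simp
  qed
  from bchoice[OF this] obtain r where r: "\<And>t. t \<in> T \<Longrightarrow> r t \<in> \<Gamma>" "\<And>t. t \<in> T \<Longrightarrow> snd (snd (r t)) = t"
    by blast
  define C where "C = (\<Union>t\<in>T. (\<lambda>k. k \<odot> r t) ` cball 0 N)"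
  have "compact C"
    unfolding C_def
    using \<open>finite T\<close> by (intro compact_UN compact_continuous_image continuous_intros compact_cball)
  then obtain B where B: "\<forall>c\<in>C. norm c \<le> B"
    using compact_imp_bounded bounded_iff by metis
  have "\<exists>z l. (z, l, 0) \<in> \<Gamma> \<and> norm (w - l) \<le> B" for w
  proof -
    obtain k \<gamma> where k: "k \<in> cball 0 N" "\<gamma> \<in> \<Gamma>" "(0, w, 0) = k \<odot> \<gamma>"
      using N by blast
    obtain k1 k2 k3 z v t where kc: "k = (k1, k2, k3)" and \<gamma>c: "\<gamma> = (z, v, t)"
      by (metis prod_cases3)
    have "k3 + t = 0"
      using k(3) by (simp add: kc \<gamma>c mult_Osc)
    moreover have "\<bar>k3\<bar> \<le> N"
      using k(1) norm_components_le(3)[of k1 k2 k3 N] by (simp add: kc)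
    ultimately have "\<bar>t\<bar> \<le> N"
      by linarith
    then have t: "t \<in> T"
      using k(2) unfolding T_def \<gamma>c by blast
    let ?h = "osc_inv (r t) \<odot> \<gamma>"
    obtain h1 l h3 where h: "?h = (h1, l, h3)"
      by (metis prod_cases3)
    have "h3 = 0"
      using arg_cong[OF h, of "\<lambda>p. snd (snd p)"] r(2)[OF t]
      by (simp add: mult_Osc_proj inv_Osc_proj \<gamma>c)
    obtain c1 c2 c3 where c: "k \<odot> r t = (c1, c2, c3)"
      by (metis prod_cases3)
    have "(0, w, 0) = (k \<odot> r t) \<odot> ?h"
      unfolding k(3) by (simp add: m_assoc)
    then have "c3 = 0" "w = c2 + l"
      unfolding c h \<open>h3 = 0\<close> by (simp_all add: mult_Osc)
    moreover have "norm (c1, c2, c3) \<le> B"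
      unfolding c[symmetric] by (intro B[rule_format]) (use t k(1) C_def in blast)
    then have "norm c2 \<le> B"
      by (rule norm_components_le)
    moreover have "(h1, l, 0) \<in> \<Gamma>"
      using \<Gamma>_mult[OF \<Gamma>_inv[OF r(1)[OF t]] k(2)] unfolding h \<open>h3 = 0\<close> .
    ultimately show ?thesis
      by (intro exI[of _ h1] exI[of _ l]) simp
  qed
  then show ?thesis
    by blast
qed

text \<open>If all times were bounded by M, the point of the t-axis at M + N + 1 would be out of
  reach of a ball of radius N times \<Gamma>.\<close>

lemma infinite_times: "infinite {t. \<exists>z v. (z, v, t) \<in> \<Gamma>}"
proof
  assume "finite {t. \<exists>z v. (z, v, t) \<in> \<Gamma>}"
  then have "bounded {t. \<exists>z v. (z, v, t) \<in> \<Gamma>}"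
    by (rule finite_imp_bounded)
  then obtain M where M: "\<forall>t\<in>{t. \<exists>z v. (z, v, t) \<in> \<Gamma>}. \<bar>t\<bar> \<le> M"
    unfolding bounded_real by (rule exE)
  obtain N where N: "\<And>g. \<exists>k\<in>cball 0 N. \<exists>\<gamma>\<in>\<Gamma>. g = k \<odot> \<gamma>"
    using cocompact by blast
  obtain k \<gamma> where k: "k \<in> cball 0 N" "\<gamma> \<in> \<Gamma>" "(0, 0, M + N + 1) = k \<odot> \<gamma>"
    using N by blast
  obtain k1 k2 k3 z v t where kc: "k = (k1, k2, k3)" and \<gamma>c: "\<gamma> = (z, v, t)"
    by (metis prod_cases3)
  have "M + N + 1 = k3 + t"
    using k(3) by (simp add: kc \<gamma>c mult_Osc)
  moreover have "\<bar>k3\<bar> \<le> N"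
    using k(1) norm_components_le(3)[of k1 k2 k3 N] by (simp add: kc)
  moreover have "\<bar>t\<bar> \<le> M"
    using M k(2) unfolding \<gamma>c by blast
  ultimately show False
    by linarith
qed

text \<open>Conjugating (z0, w, 0) by an element of time t rotates w by R(t). A central element of
  \<Gamma> brings the z-coordinate back into a bounded range, and the norm of w is preserved, so
  R(t) w takes finitely many values over infinitely many times. Two times therefore agree on w, and
  since w is nonzero in every block, their difference is a period.\<close>

lemma exists_period:
  assumes w: "(z0, w, 0) \<in> \<Gamma>" "\<And>i. w $ (i, 1) \<noteq> 0"
    and center: "\<And>a. \<exists>z. (z, 0, 0) \<in> \<Gamma> \<and> \<bar>a - z\<bar> \<le> B"
  shows "\<exists>t. t > 0 \<and> (\<forall>v. rot lam t v = v)"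
proof -
  let ?D = "{t. \<exists>z v. (z, v, t) \<in> \<Gamma>}"
  let ?E = "\<Gamma> \<inter> cball 0 B \<times> cball 0 (norm w) \<times> {0}"
  have "finite ?E"
    by (intro finite_\<Gamma>_Int compact_Times compact_cball) simp
  moreover have "(\<lambda>t. rot lam t w) ` ?D \<subseteq> (\<lambda>p. fst (snd p)) ` ?E"
  proof (rule image_subsetI)
    fix t assume "t \<in> ?D"
    then obtain z v where \<gamma>: "(z, v, t) \<in> \<Gamma>" by blast
    obtain y where y: "(z, v, t) \<odot> (z0, w, 0) \<odot> osc_inv (z, v, t) = (y, rot lam t w, 0)"
      by (simp add: mult_Osc inv_Osc rot_minus)
    have y\<Gamma>: "(y, rot lam t w, 0) \<in> \<Gamma>"
      unfolding y[symmetric] by (intro \<Gamma>_mult \<Gamma>_inv \<gamma> w)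
    obtain u where u: "(u, 0, 0) \<in> \<Gamma>" "\<bar>y - u\<bar> \<le> B"
      using center by blast
    have "osc_inv (u, 0, 0) \<odot> (y, rot lam t w, 0) = (y - u, rot lam t w, 0)"
      by (simp add: inv_Osc mult_Osc)
    then have "(y - u, rot lam t w, 0) \<in> \<Gamma>"
      using \<Gamma>_mult[OF \<Gamma>_inv[OF u(1)] y\<Gamma>] by simp
    then have "(y - u, rot lam t w, 0) \<in> ?E"
      using u(2) by simp
    then show "rot lam t w \<in> (\<lambda>p. fst (snd p)) ` ?E"
      by (rule rev_image_eqI) simp
  qed
  ultimately have "finite ((\<lambda>t. rot lam t w) ` ?D)"
    by (meson finite_imageI finite_subset)
  then have "\<not> inj_on (\<lambda>t. rot lam t w) ?D"
    using infinite_times finite_imageD by blast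
  then obtain t t' where t: "t \<noteq> t'" "rot lam t w = rot lam t' w"
    unfolding inj_on_def by blast
  have period: "rot lam (b - a) v = v" if "rot lam a w = rot lam b w" for a b v
  proof (rule rot_eq_self, rule allI)
    fix i
    have "rot lam (b - a) w = rot lam (- a) (rot lam b w)"
      by simp
    also have "\<dots> = w"
      unfolding that[symmetric] by simp
    finally show "cos ((b - a) * lam i) = 1"
      using w(2) by (rule rot_fixed_imp_cos)
  qed
  show ?thesis
  proof (cases "t < t'")
    case True
    then show ?thesis
      using period[OF t(2)] by (intro exI[of _ "t' - t"]) simp
  next
    case False
    then show ?thesis
      using period[OF t(2)[symmetric]] t(1) by (intro exI[of _ "t - t'"]) simp
  qed
qed

lemma singular_elements_case:
  assumes "\<forall>z v t. (z, v, t) \<in> \<Gamma> \<longrightarrow> (\<exists>i. cos (t * lam i) = 1)"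
  shows "(\<exists>z t. z > 0 \<and> t > 0 \<and> (z, 0, t) \<in> \<Gamma>) \<and> (\<exists>z t. z < 0 \<and> t > 0 \<and> (z, 0, t) \<in> \<Gamma>)"
proof -
  let ?L = "{l. \<exists>z. (z, l, 0) \<in> \<Gamma>}"
  obtain B where B: "\<And>w. \<exists>z l. (z, l, 0) \<in> \<Gamma> \<and> norm (w - l) \<le> B"
    using nilradical_cocompact[OF assms] by blast
  have "span ?L = UNIV"
  proof (rule subspace_near_imp_UNIV[OF subspace_span])
    show "\<exists>l\<in>span ?L. norm (w - l) \<le> B" for w
      using B[of w] by (blast intro: span_base)
  qed
  obtain A where A: "A \<subseteq> ?L" "finite A" "span A = UNIV"
  proof -
    obtain A where "A \<subseteq> ?L" "independent A" "?L \<subseteq> span A"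
      using maximal_independent_subset by blast
    then have "UNIV \<subseteq> span (span A)"
      using span_mono[of ?L "span A"] \<open>span ?L = UNIV\<close> by simp
    then have "span A = UNIV"
      unfolding span_span by blast
    then show thesis
      using that[OF \<open>A \<subseteq> ?L\<close> independent_imp_finite[OF \<open>independent A\<close>]] by blast
  qed
  have "\<forall>l\<in>A. \<exists>z. (z, l, 0) \<in> \<Gamma>"
    using A(1) by blast
  from bchoice[OF this] obtain f where f: "\<forall>l\<in>A. (f l, l, 0) \<in> \<Gamma>"
    by (rule exE)
  define S where "S = (\<lambda>l. (f l, l, 0 :: real)) ` A"
  have S: "finite S" "S \<subseteq> \<Gamma>"
    unfolding S_def using A(2) f by blast+
  have centralizer: "v = 0 \<and> (\<forall>w. rot lam t w = w)"
    if comm: "\<And>s. s \<in> S \<Longrightarrow> (z, v, t) \<odot> s = s \<odot> (z, v, t)" for z v t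
  proof -
    \<comment> \<open>The v-components of the commutation give R(t) l = l. The z-components then
      give that \<open>sform v l\<close> is symmetric, so it vanishes by antisymmetry.\<close>
    have "rot lam t l = l \<and> sform v l = 0" if "l \<in> A" for l
    proof -
      have eq: "(z, v, t) \<odot> (f l, l, 0) = (f l, l, 0) \<odot> (z, v, t)"
        by (rule comm) (simp add: S_def that)
      then have r: "rot lam t l = l"
        by (simp add: mult_Osc add.commute)
      with eq have "sform v l = sform l v"
        by (simp add: mult_Osc)
      then show ?thesis
        using r sform_swap[of v l] by simp
    qed
    moreover have "subspace {l. rot lam t l = l \<and> sform v l = 0}"
      by (auto simp: subspace_def rot_add rot_scaleR sform_add_right sform_scaleR_right)
    ultimately have "span A \<subseteq> {l. rot lam t l = l \<and> sform v l = 0}"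
      by (intro span_minimal) blast+
    then have "\<And>l. rot lam t l = l \<and> sform v l = 0"
      unfolding A by blast
    then show ?thesis
      using sform_nondegenerate by blast
  qed
  have commute: "(a, 0, t) \<odot> s = s \<odot> (a, 0, t)" if "\<And>w. rot lam t w = w" "s \<in> S" for a t s
    using that unfolding S_def by (auto simp: mult_Osc add.commute)
  \<comment> \<open>An element of \<Gamma> that centralizes S at a nonzero time is itself a source
    of a period. Otherwise all elements of \<Gamma> centralizing S lie in the center of the group,
    Selberg's lemma makes \<Gamma> cocompact in the center, and \<open>exists_period\<close>
    applies.\<close>
  obtain \<tau> where \<tau>: "\<tau> > 0" "\<And>w. rot lam \<tau> w = w"
  proof (cases "\<exists>z v t. (z, v, t) \<in> \<Gamma> \<and> (\<forall>s\<in>S. (z, v, t) \<odot> s = s \<odot> (z, v, t)) \<and> t \<noteq> 0")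
    case True
    then obtain z v t where t: "t \<noteq> 0" "\<And>w. rot lam t w = w"
      using centralizer by blast
    have "rot lam (- t) w = w" for w
      using rot_rot[of lam "- t" t w] unfolding t(2) by simp
    with t show ?thesis
      using that[of "\<bar>t\<bar>"] by (auto simp: abs_if)
  next
    case False
    obtain C where C: "compact C" "\<And>g. (\<And>s. s \<in> S \<Longrightarrow> g \<odot> s = s \<odot> g) \<Longrightarrow>
       \<exists>c\<in>C. \<exists>\<zeta>\<in>\<Gamma>. g = c \<odot> \<zeta> \<and> (\<forall>s\<in>S. \<zeta> \<odot> s = s \<odot> \<zeta>)"
      using centralizer_cocompact[OF S] by blast
    obtain B' where B': "\<forall>c\<in>C. norm c \<le> B'"
      using compact_imp_bounded[OF C(1)] bounded_iff by metis
    have center: "\<exists>z. (z, 0, 0) \<in> \<Gamma> \<and> \<bar>a - z\<bar> \<le> B'" for a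
    proof -
      have "\<exists>c\<in>C. \<exists>\<zeta>\<in>\<Gamma>. (a, 0, 0) = c \<odot> \<zeta> \<and> (\<forall>s\<in>S. \<zeta> \<odot> s = s \<odot> \<zeta>)"
        by (rule C(2), rule commute) simp_all
      then obtain c \<zeta> where c: "c \<in> C" "\<zeta> \<in> \<Gamma>" "(a, 0, 0) = c \<odot> \<zeta>" "\<forall>s\<in>S. \<zeta> \<odot> s = s \<odot> \<zeta>"
        by blast
      obtain z v t where \<zeta>: "\<zeta> = (z, v, t)"
        by (metis prod_cases3)
      have "t = 0" "v = 0"
        using c(2,4) False centralizer[of z v t] unfolding \<zeta> by blast+
      obtain c1 c2 c3 where cc: "c = (c1, c2, c3)"
        by (metis prod_cases3)
      have "c1 = a - z"
        using c(3) unfolding \<zeta> cc \<open>t = 0\<close> \<open>v = 0\<close> by (simp add: mult_Osc)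
      moreover have "\<bar>c1\<bar> \<le> B'"
        using B'[rule_format, OF c(1)] unfolding cc by (rule norm_components_le)
      ultimately show ?thesis
        using c(2) unfolding \<zeta> \<open>t = 0\<close> \<open>v = 0\<close> by blast
    qed
    \<comment> \<open>A vector within B of the one with all coordinates B + 1 has no zero
      coordinate.\<close>
    obtain z0 w where w: "(z0, w, 0) \<in> \<Gamma>" "norm ((\<chi> p. B + 1) - w) \<le> B"
      using B by blast
    have "w $ (i, 1) \<noteq> 0" for i
      using component_le_norm_cart[of "(\<chi> p. B + 1) - w" "(i, 1)"] w(2) by auto
    then show ?thesis
      using exists_period[OF w(1) _ center] that by blast
  qed
  have "rot lam (real m * \<tau>) w = w" for m w
  proof (induction m)
    case (Suc m)
    have "rot lam (real (Suc m) * \<tau>) w = rot lam \<tau> (rot lam (real m * \<tau>) w)"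
      by (simp add: algebra_simps)
    then show ?case
      by (simp only: Suc \<tau>(2))
  qed simp
  note rot_m = this
  have *: "\<exists>z t. g = osc_inv (0, 0, 0) \<odot> (z, 0, t) \<odot> (0, 0, 0)"
    if "\<And>s. s \<in> S \<Longrightarrow> g \<odot> s = s \<odot> g" for g
  proof -
    obtain z v t where g: "g = (z, v, t)"
      by (metis prod_cases3)
    show ?thesis
      unfolding conj_0 using centralizer[of z v t] that unfolding g by blast
  qed
  have **: "osc_inv (0, 0, 0) \<odot> (a, 0, real m * \<tau>) \<odot> (0, 0, 0) \<odot> s =
      s \<odot> (osc_inv (0, 0, 0) \<odot> (a, 0, real m * \<tau>) \<odot> (0, 0, 0))" if "s \<in> S" for a m s
    unfolding conj_0 by (rule commute[OF rot_m that])
  note ex = exists_conj_in_\<Gamma>[where p = "(0, 0, 0)", OF S * \<tau>(1) **, unfolded conj_0]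
  show ?thesis
    by (intro conjI ex)
qed

lemma exists_conj_in_both_quadrants:
  "\<exists>x. (\<exists>z t. z > 0 \<and> t > 0 \<and> osc_inv (0, x, 0) \<odot> (z, 0, t) \<odot> (0, x, 0) \<in> \<Gamma>) \<and>
    (\<exists>z t. z < 0 \<and> t > 0 \<and> osc_inv (0, x, 0) \<odot> (z, 0, t) \<odot> (0, x, 0) \<in> \<Gamma>)"
proof (cases "\<exists>z v t. (z, v, t) \<in> \<Gamma> \<and> (\<forall>i. cos (t * lam i) \<noteq> 1)")
  case True
  then show ?thesis
    using regular_element_case by blast
next
  case False
  then have *: "\<forall>z v t. (z, v, t) \<in> \<Gamma> \<longrightarrow> (\<exists>i. cos (t * lam i) = 1)"
    by blast
  show ?thesis
    using singular_elements_case[OF *] by (intro exI[of _ 0]) (unfold conj_0)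
qed

end

theorem theorem3p6:
  fixes lam :: "'n::finite \<Rightarrow> real" and \<Gamma> :: "'n osc set"
  assumes "\<forall>i. lam i > 0"
    and "lattice_in_Osc lam \<Gamma>"
  shows "(\<exists>\<gamma>. timelike_geodesic lam \<Gamma> \<gamma> \<and> closed_curve \<gamma>) \<and>
         (\<exists>\<gamma>. timelike_geodesic lam \<Gamma> \<gamma> \<and> open_curve \<gamma>) \<and>
         (\<exists>\<gamma>. spacelike_geodesic lam \<Gamma> \<gamma> \<and> closed_curve \<gamma>) \<and>
         (\<exists>\<gamma>. spacelike_geodesic lam \<Gamma> \<gamma> \<and> open_curve \<gamma>)"
proof -
  interpret osc_lattice lam \<Gamma>
    using assms by unfold_locales
  obtain x z t z' t' where "z > 0" "t > 0" "osc_inv (0, x, 0) \<odot> (z, 0, t) \<odot> (0, x, 0) \<in> \<Gamma>"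
    and "z' < 0" "t' > 0" "osc_inv (0, x, 0) \<odot> (z', 0, t') \<odot> (0, x, 0) \<in> \<Gamma>"
    using exists_conj_in_both_quadrants by blast
  then have closed: "closed_curve (\<lambda>s. proj lam \<Gamma> (osc_curve lam z t x s))" "z * t > 0"
    "closed_curve (\<lambda>s. proj lam \<Gamma> (osc_curve lam z' t' x s))" "z' * t' < 0"
    by (simp_all only: closed_curve_osc_curve mult_pos_pos mult_neg_pos)
  \<comment> \<open>The open geodesics start at the identity with scalar squares 2b > 0 and -2b' <
    0: \<sigma> = 1 gives the spacelike one, \<sigma> = -1 the timelike one.\<close>
  obtain b where b: "b > 0" "\<And>L. L > 0 \<Longrightarrow> (1 * L, 0, b * L) \<notin> \<Gamma>"
    using exists_slope_avoiding_\<Gamma>[of 1] by (metis zero_neq_one)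
  obtain b' where b': "b' > 0" "\<And>L. L > 0 \<Longrightarrow> (- 1 * L, 0, b' * L) \<notin> \<Gamma>"
    using exists_slope_avoiding_\<Gamma>[of "- 1"] by (metis neg_equal_0_iff_equal zero_neq_one)
  have "1 * b > 0" "- 1 * b' < 0"
    using b(1) b'(1) by simp_all
  then show ?thesis
    using closed open_curve_osc_curve[OF b(2)] open_curve_osc_curve[OF b'(2)]
      timelike_geodesic_osc_curve[OF assms(1)] spacelike_geodesic_osc_curve[OF assms(1)]
    by blast
qed

end
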